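(* Suppose that $\varphi_{1},\varphi_{2}:\mathbb{D}\to\mathbb{D}$ are analytic functions. Then there exist unique continuous functions $\omega_{1},\omega_{2}:\overline{\mathbb{D}}\to\overline{\mathbb{D}}$ that are analytic on $\mathbb{D}$ and satisfy $\omega_{1}(0)=\omega_{2}(0)=0$ and \[ \omega_{1}(z)\varphi_{1}(\omega_{1}(z))=\omega_{2}(z)\varphi_{2}(\omega_{2}(z))=\frac{\omega_{1}(z)\omega_{2}(z)}{z},\qquad z\in\mathbb{D}\setminus\{0\}. \]
   Context: $\mathbb{D}$ denotes the open unit disk in the complex plane $\mathbb{C}$, and $\overline{\mathbb{D}}$ denotes its closure.
   Formalization: Uniqueness as printed fails (ω1=ω2=0 always solves); it is proved among solutions with neither ω1 nor ω2 identically zero or satisfying the cancelled equations φ1(ω1(z))=ω2(z)/z, φ2(ω2(z))=ω1(z)/z, which the solution found also satisfies. *)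

theory Defs
  imports "HOL-Complex_Analysis.Complex_Analysis"
begin

text \<open>
  Functions on the open and closed unit discs are total functions on the complex numbers, of
  which only the values on \<open>ball 0 1\<close> and \<open>cball 0 1\<close> matter; uniqueness is
  therefore equality on \<open>cball 0 1\<close>.
\<close>

definition self_map_of_disc :: "(complex \<Rightarrow> complex) \<Rightarrow> bool" where
  "self_map_of_disc \<phi> \<longleftrightarrow> \<phi> holomorphic_on ball 0 1 \<and> \<phi> ` ball 0 1 \<subseteq> ball 0 1"

text \<open>
  By the maximum principle such an \<open>\<omega>\<close> maps the open disc into itself, so that
  \<open>\<phi> (\<omega> z)\<close> below never uses a value of \<open>\<phi>\<close> outside the open disc.
\<close>

definition closed_disc_map :: "(complex \<Rightarrow> complex) \<Rightarrow> bool" where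
  "closed_disc_map \<omega> \<longleftrightarrow>
     continuous_on (cball 0 1) \<omega> \<and> \<omega> ` cball 0 1 \<subseteq> cball 0 1 \<and>
     \<omega> holomorphic_on ball 0 1 \<and> \<omega> 0 = 0"

definition subordination_eqs ::
  "(complex \<Rightarrow> complex) \<Rightarrow> (complex \<Rightarrow> complex) \<Rightarrow> (complex \<Rightarrow> complex) \<Rightarrow> (complex \<Rightarrow> complex) \<Rightarrow> bool"
  where
  "subordination_eqs \<phi>1 \<phi>2 \<omega>1 \<omega>2 \<longleftrightarrow>
     (\<forall>z \<in> ball 0 1 - {0}.
        \<omega>1 z * \<phi>1 (\<omega>1 z) = \<omega>2 z * \<phi>2 (\<omega>2 z) \<and>
        \<omega>2 z * \<phi>2 (\<omega>2 z) = \<omega>1 z * \<omega>2 z / z)"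

text \<open>
  The pair \<open>\<omega>1 = \<omega>2 = 0\<close> solves the subordination equations for every \<open>\<phi>1\<close>,
  \<open>\<phi>2\<close>, and if \<open>\<phi>1 = 0\<close> then so does \<open>\<omega>2 = 0\<close> with an arbitrary
  \<open>\<omega>1\<close>. Uniqueness thus cannot hold among all solutions of these equations. It is
  restored by reading them with the common factors \<open>\<omega>1 z\<close> and \<open>\<omega>2 z\<close>
  cancelled, which changes nothing unless \<open>\<omega>1\<close> or \<open>\<omega>2\<close> vanishes identically.
\<close>

definition cancelled_subordination_eqs ::
  "(complex \<Rightarrow> complex) \<Rightarrow> (complex \<Rightarrow> complex) \<Rightarrow> (complex \<Rightarrow> complex) \<Rightarrow> (complex \<Rightarrow> complex) \<Rightarrow> bool"
  where
  "cancelled_subordination_eqs \<phi>1 \<phi>2 \<omega>1 \<omega>2 \<longleftrightarrow>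
     (\<forall>z \<in> ball 0 1 - {0}. \<phi>1 (\<omega>1 z) = \<omega>2 z / z \<and> \<phi>2 (\<omega>2 z) = \<omega>1 z / z)"

end

(*
  With the common factors cancelled, the equations say \<omega>2 z = z \<phi>1(\<omega>1 z) and \<omega>1 z = z \<phi>2(\<omega>2 z), so
  \<omega>1 z is a fixed point of w \<mapsto> z \<phi>2(z \<phi>1(w)).  By the Schwarz-Pick lemma this map contracts the
  hyperbolic metric by a factor |z|^2, which gives existence, uniqueness and holomorphy on the
  open disc.  Continuity up to the boundary is shown as uniform continuity on the open disc.
  The fixed point equations force the defects 1 - |\<omega>1|^2, 1 - |\<phi>1(\<omega>1)|^2 and 1 - |\<omega>2|^2 to be
  comparable, and they bound the difference of values of \<omega>1 at two points z, z' by a multiple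
  of |z - z'| as soon as one of the two Schwarz-Pick inequalities involved is strict by a fixed
  amount.  If \<phi>1 is not an automorphism, then its composition with an automorphism is w \<psi>(w) with
  \<psi> a self-map of the disc, and the Schwarz-Pick inequality for \<psi> makes the one for \<phi>1 strict,
  uniformly up to the boundary, for points whose distance is bounded below.  If both
  \<phi>1 and \<phi>2 are automorphisms, then \<omega>1 solves a quadratic equation, so its cluster sets at
  boundary points are finite; being connected, they are singletons.
*)
theory Submission
  imports Defs
begin

section \<open>The Schwarz-Pick lemma\<close>

text \<open>The square of \<open>sinh (d / 2)\<close>, where \<open>d\<close> is the distance in the hyperbolic
  metric of curvature \<open>-1\<close>.\<close>

definition sinh_sq :: "complex \<Rightarrow> complex \<Rightarrow> real" where
  "sinh_sq a b = (cmod (a - b))\<^sup>2 / ((1 - (cmod a)\<^sup>2) * (1 - (cmod b)\<^sup>2))"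

lemma defect_pos: "cmod a < 1 \<Longrightarrow> 0 < 1 - (cmod a)\<^sup>2"
  by (simp add: abs_square_less_1)

lemma one_minus_cnj_mult_nonzero:
  assumes "cmod p < 1" "cmod w < 1"
  shows "1 - cnj p * w \<noteq> 0"
  by (metis assms complex_mod_cnj norm_mult_less norm_one mult_1 right_minus_eq less_irrefl)

section \<open>Disc automorphisms and the invariance of the hyperbolic metric\<close>

lemma norm_one_minus_mult_cnj:
  "(cmod (1 - a * cnj b))\<^sup>2 = (1 - (cmod a)\<^sup>2) * (1 - (cmod b)\<^sup>2) + (cmod (a - b))\<^sup>2"
  unfolding cmod_power2 by (simp add: algebra_simps power2_eq_square)

text \<open>The factor \<open>1 + sinh_sq a b\<close> is the squared hyperbolic cosine of half the
  distance. In this multiplicative form the Schwarz-Pick inequality becomes a bound for entries of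
  Pick matrices.\<close>

lemma norm_one_minus_mult_cnj_sinh_sq:
  assumes "cmod a < 1" "cmod b < 1"
  shows "(cmod (1 - a * cnj b))\<^sup>2 = (1 - (cmod a)\<^sup>2) * (1 - (cmod b)\<^sup>2) * (1 + sinh_sq a b)"
  using defect_pos[OF assms(1)] defect_pos[OF assms(2)]
  by (simp add: norm_one_minus_mult_cnj sinh_sq_def distrib_left)

lemma Moebius_function_diff:
  assumes "cmod p < 1" "cmod w < 1" "cmod w' < 1"
  shows "Moebius_function 0 p w - Moebius_function 0 p w' =
         of_real (1 - (cmod p)\<^sup>2) * (w - w') / ((1 - cnj p * w) * (1 - cnj p * w'))"
  using one_minus_cnj_mult_nonzero[OF assms(1,2)] one_minus_cnj_mult_nonzero[OF assms(1,3)]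
  unfolding Moebius_function_simple of_real_diff complex_norm_square
  by (simp add: divide_simps) (simp add: algebra_simps)

lemma Moebius_function_defect:
  assumes "cmod p < 1" "cmod w < 1"
  shows "1 - (cmod (Moebius_function 0 p w))\<^sup>2 =
         (1 - (cmod p)\<^sup>2) * (1 - (cmod w)\<^sup>2) / (cmod (1 - cnj p * w))\<^sup>2"
proof -
  have "(cmod (1 - cnj p * w))\<^sup>2 - (cmod (w - p))\<^sup>2 = (1 - (cmod p)\<^sup>2) * (1 - (cmod w)\<^sup>2)"
    using norm_one_minus_mult_cnj[of w p] by (simp add: mult.commute)
  moreover have "cmod (1 - cnj p * w) \<noteq> 0"
    using one_minus_cnj_mult_nonzero[OF assms] by simp
  ultimately show ?thesis
    by (simp add: Moebius_function_simple norm_divide power_divide field_simps)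
qed

text \<open>By \<open>Moebius_function_diff\<close> and \<open>Moebius_function_defect\<close>, the
  numerator and the product of the two defects acquire the same factors, which cancel.\<close>

lemma sinh_sq_Moebius:
  assumes "cmod p < 1" "cmod w < 1" "cmod w' < 1"
  shows "sinh_sq (Moebius_function 0 p w) (Moebius_function 0 p w') = sinh_sq w w'"
proof -
  have "cmod (1 - cnj p * w) \<noteq> 0" "cmod (1 - cnj p * w') \<noteq> 0" "1 - (cmod p)\<^sup>2 \<noteq> 0"
    using one_minus_cnj_mult_nonzero[OF assms(1,2)] one_minus_cnj_mult_nonzero[OF assms(1,3)]
      defect_pos[OF assms(1)] by simp_all
  moreover have "P\<^sup>2 * d / (x * y) / (P * W / x * (P * W' / y)) = d / (W * W')"
    if "P \<noteq> 0" "x \<noteq> 0" "y \<noteq> 0" for P d x y W W' :: real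
    using that by (cases "W = 0 \<or> W' = 0") (auto simp: field_simps power2_eq_square)
  ultimately show ?thesis
    unfolding sinh_sq_def Moebius_function_diff[OF assms] Moebius_function_defect[OF assms(1,2)]
      Moebius_function_defect[OF assms(1,3)]
    by (simp only: norm_divide norm_mult norm_of_real power_divide power_mult_distrib power2_abs
        power_eq_0_iff not_False_eq_True simp_thms)
qed

section \<open>The Schwarz-Pick inequality and estimates for defects\<close>

lemma sinh_sq_nonneg:
  assumes "cmod a < 1" "cmod b < 1"
  shows "0 \<le> sinh_sq a b"
  unfolding sinh_sq_def using defect_pos[OF assms(1)] defect_pos[OF assms(2)] by simp

lemma sinh_sq_zero_mono:
  assumes "cmod x \<le> cmod y" "cmod y < 1"
  shows "sinh_sq x 0 \<le> sinh_sq y 0"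
proof -
  have "(cmod x)\<^sup>2 \<le> (cmod y)\<^sup>2"
    using assms by (simp add: power_mono)
  then show ?thesis
    using defect_pos[OF assms(2)] by (simp add: sinh_sq_def frac_le)
qed

lemma self_map_of_disc_norm:
  assumes "self_map_of_disc \<phi>" "cmod a < 1"
  shows "cmod (\<phi> a) < 1"
  using assms by (force simp: self_map_of_disc_def)

lemma self_map_of_disc_Moebius:
  "cmod p < 1 \<Longrightarrow> self_map_of_disc (Moebius_function 0 p)"
  by (auto simp: self_map_of_disc_def Moebius_function_holomorphic Moebius_function_norm_lt_1)

lemma self_map_of_disc_compose:
  assumes "self_map_of_disc f" "self_map_of_disc g"
  shows "self_map_of_disc (f \<circ> g)"
  using assms holomorphic_on_compose_gen[of g "ball 0 1" f "ball 0 1"]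
  by (auto simp: self_map_of_disc_def)

text \<open>Automorphisms moving \<open>b\<close> and \<open>\<phi> b\<close> to the origin preserve
  \<open>sinh_sq\<close> and reduce the claim to the Schwarz lemma, because
  \<open>sinh_sq x 0\<close> increases with \<open>cmod x\<close>.\<close>

lemma Schwarz_Pick:
  assumes \<phi>: "self_map_of_disc \<phi>" and a: "cmod a < 1" and b: "cmod b < 1"
  shows "sinh_sq (\<phi> a) (\<phi> b) \<le> sinh_sq a b"
proof -
  let ?f = "Moebius_function 0 (\<phi> b) \<circ> (\<phi> \<circ> Moebius_function 0 (- b))"
  let ?\<xi> = "Moebius_function 0 b a"
  have \<phi>a: "cmod (\<phi> a) < 1" and \<phi>b: "cmod (\<phi> b) < 1"
    using self_map_of_disc_norm[OF \<phi>] a b by auto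
  have f: "self_map_of_disc ?f"
    using \<phi> b \<phi>b by (simp add: self_map_of_disc_compose self_map_of_disc_Moebius)
  have f0: "?f 0 = 0"
    by (simp add: Moebius_function_of_zero Moebius_function_eq_zero)
  have \<xi>: "cmod ?\<xi> < 1"
    using Moebius_function_norm_lt_1[OF b a] .
  have f\<xi>: "?f ?\<xi> = Moebius_function 0 (\<phi> b) (\<phi> a)"
    using Moebius_function_compose[of "- b" b a] a b by simp
  have "cmod (?f ?\<xi>) \<le> cmod ?\<xi>"
    using Schwarz_Lemma(1)[of ?f ?\<xi>] f f0 \<xi> self_map_of_disc_norm[OF f]
    unfolding self_map_of_disc_def by blast
  then have "sinh_sq (?f ?\<xi>) 0 \<le> sinh_sq ?\<xi> 0"
    using \<xi> by (rule sinh_sq_zero_mono)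
  then show ?thesis
    using sinh_sq_Moebius[OF \<phi>b \<phi>a \<phi>b] sinh_sq_Moebius[OF b a b]
    by (simp only: f\<xi> Moebius_function_eq_zero)
qed

lemma defect_mult_le:
  "cmod z \<le> 1 \<Longrightarrow> 1 - (cmod w)\<^sup>2 \<le> 1 - (cmod (z * w))\<^sup>2"
  using mult_left_le_one_le[of "(cmod w)\<^sup>2" "(cmod z)\<^sup>2"]
  by (simp add: norm_mult power_mult_distrib power_le_one)

text \<open>Multiplication by \<open>z\<close> scales the numerator by exactly
  \<open>(cmod z)\<^sup>2\<close> and does not decrease the defects. This is the source of the
  strict contraction.\<close>

lemma sinh_sq_scale:
  assumes z: "cmod z \<le> 1" and a: "cmod a < 1" and b: "cmod b < 1"
  shows "sinh_sq (z * a) (z * b) \<le> (cmod z)\<^sup>2 * sinh_sq a b"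
proof -
  note le = defect_mult_le[OF z]
  have "(1 - (cmod a)\<^sup>2) * (1 - (cmod b)\<^sup>2) \<le> (1 - (cmod (z * a))\<^sup>2) * (1 - (cmod (z * b))\<^sup>2)"
    using le[of a] le[of b] defect_pos[OF a] defect_pos[OF b] by (intro mult_mono) linarith+
  then have "sinh_sq (z * a) (z * b) \<le>
      (cmod (z * a - z * b))\<^sup>2 / ((1 - (cmod a)\<^sup>2) * (1 - (cmod b)\<^sup>2))"
    unfolding sinh_sq_def using defect_pos[OF a] defect_pos[OF b] by (intro frac_le) auto
  also have "\<dots> = (cmod z)\<^sup>2 * sinh_sq a b"
    by (simp add: sinh_sq_def norm_mult power_mult_distrib flip: right_diff_distrib)
  finally show ?thesis .
qed

lemma norm_diff_le_sinh_sq: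
  assumes "cmod a < 1" "cmod b < 1"
  shows "(cmod (a - b))\<^sup>2 \<le> sinh_sq a b"
proof -
  have "(1 - (cmod a)\<^sup>2) * (1 - (cmod b)\<^sup>2) \<le> 1"
    using defect_pos[OF assms(1)] defect_pos[OF assms(2)] by (intro mult_le_one) auto
  then show ?thesis
    unfolding sinh_sq_def using defect_pos[OF assms(1)] defect_pos[OF assms(2)]
    by (simp add: pos_le_divide_eq mult_left_le)
qed

lemma Moebius_defect_le:
  assumes "cmod p < 1" "cmod w < 1"
  shows "1 - (cmod (Moebius_function 0 p w))\<^sup>2 \<le> (1 - (cmod w)\<^sup>2) / (1 - cmod p)\<^sup>2"
proof -
  have "cmod (cnj p * w) \<le> cmod p"
    using assms by (simp add: norm_mult mult_left_le)
  then have "1 - cmod p \<le> cmod (1 - cnj p * w)"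
    using norm_triangle_ineq2[of 1 "cnj p * w"] by simp
  then have "(1 - cmod p)\<^sup>2 \<le> (cmod (1 - cnj p * w))\<^sup>2"
    using assms by (intro power_mono) auto
  moreover have "(1 - (cmod p)\<^sup>2) * (1 - (cmod w)\<^sup>2) \<le> 1 - (cmod w)\<^sup>2"
    using defect_pos[OF assms(2)] by (simp add: mult_left_le_one_le defect_pos assms less_imp_le)
  ultimately show ?thesis
    unfolding Moebius_function_defect[OF assms] using assms defect_pos[OF assms(2)]
    by (intro frac_le) auto
qed

text \<open>After the automorphism that sends \<open>\<phi> 0\<close> to 0, the Schwarz lemma says
  that the defect does not decrease. The automorphism itself enlarges defects at most by the factor
  \<open>1 / (1 - cmod (\<phi> 0))\<^sup>2\<close>.\<close>

lemma self_map_of_disc_defect_ge: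
  assumes \<phi>: "self_map_of_disc \<phi>"
  obtains c where "c > 0" "\<And>u. cmod u < 1 \<Longrightarrow> c * (1 - (cmod u)\<^sup>2) \<le> 1 - (cmod (\<phi> u))\<^sup>2"
proof
  let ?p = "\<phi> 0"
  have p: "cmod ?p < 1"
    using self_map_of_disc_norm[OF \<phi>, of 0] by simp
  then show "(1 - cmod ?p)\<^sup>2 > 0" by simp
  fix u :: complex assume u: "cmod u < 1"
  have \<phi>u: "cmod (\<phi> u) < 1"
    using self_map_of_disc_norm[OF \<phi> u] .
  let ?m = "Moebius_function 0 ?p"
  have "self_map_of_disc (?m \<circ> \<phi>)"
    using self_map_of_disc_compose[OF self_map_of_disc_Moebius[OF p] \<phi>] .
  then have "cmod (?m (\<phi> u)) \<le> cmod u"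
    using Schwarz_Lemma(1)[of "?m \<circ> \<phi>" u] u self_map_of_disc_norm[of "?m \<circ> \<phi>"]
    by (auto simp: self_map_of_disc_def Moebius_function_eq_zero)
  then have "1 - (cmod u)\<^sup>2 \<le> 1 - (cmod (?m (\<phi> u)))\<^sup>2"
    by (simp add: power_mono)
  also have "\<dots> \<le> (1 - (cmod (\<phi> u))\<^sup>2) / (1 - cmod ?p)\<^sup>2"
    by (rule Moebius_defect_le[OF p \<phi>u])
  finally show "(1 - cmod ?p)\<^sup>2 * (1 - (cmod u)\<^sup>2) \<le> 1 - (cmod (\<phi> u))\<^sup>2"
    using p by (simp add: field_simps)
qed

section \<open>Strictness of the Schwarz-Pick inequality\<close>

text \<open>For \<open>g w = w * \<psi> w\<close> this is applied with \<open>1 + B\<close>, \<open>1 + B'\<close> and \<open>1 + k\<close> the entries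
  \<open>(1 - g a * cnj (g b)) / (1 - a * cnj b)\<close> of the Pick matrix of \<open>g\<close> at \<open>u\<close> and \<open>u'\<close>. Its determinant
  \<open>\<delta>\<close> vanishes exactly in the case of equality in the Schwarz-Pick inequality.\<close>

lemma Schwarz_Pick_deficit:
  fixes u u' k :: complex and B B' M :: real
  defines "D \<equiv> 1 - u * cnj u'"
  defines "\<delta> \<equiv> (1 + B) * (1 + B') - (cmod (1 + k))\<^sup>2"
  assumes u: "cmod u < 1" and u': "cmod u' < 1"
    and B: "0 \<le> B" "B \<le> M" and B': "0 \<le> B'" "B' \<le> M"
    and k: "(cmod k)\<^sup>2 \<le> B * B'"
    and eq: "(1 - (1 + B) * (1 - (cmod u)\<^sup>2)) * (1 - (1 + B') * (1 - (cmod u')\<^sup>2)) =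
             (cmod (1 - (1 + k) * D))\<^sup>2"
  shows "B * (cmod (u - u'))\<^sup>2 \<le> \<delta> + 14 * sqrt (M * \<delta>)" and "0 \<le> \<delta>"
proof -
  let ?U = "1 - (cmod u)\<^sup>2" and ?U' = "1 - (cmod u')\<^sup>2" and ?x = "(cmod (u - u'))\<^sup>2"
  have k2: "(cmod (1 + k))\<^sup>2 = 1 + 2 * Re k + (cmod k)\<^sup>2"
    by (simp add: cmod_power2 power2_sum)
  have Rek: "2 * Re k \<le> B + B'"
  proof -
    have "(2 * Re k)\<^sup>2 \<le> 4 * (cmod k)\<^sup>2"
      by (simp add: cmod_power2 power_mult_distrib)
    also have "\<dots> \<le> (B + B')\<^sup>2"
      using k zero_le_power2[of "B - B'"] by (simp add: power2_eq_square algebra_simps)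
    finally show ?thesis
      using B B' by (meson add_nonneg_nonneg power2_le_imp_le)
  qed
  have \<delta>: "\<delta> = (B + B' - 2 * Re k) + (B * B' - (cmod k)\<^sup>2)"
    unfolding \<delta>_def k2 by (simp add: algebra_simps)
  then have \<delta>0: "0 \<le> \<delta>" and Re_le: "B + B' - 2 * Re k \<le> \<delta>"
    using Rek k by auto
  show "0 \<le> \<delta>" by (fact \<delta>0)
  have M\<delta>: "0 \<le> M * \<delta>"
    using B \<delta>0 by auto
  \<comment> \<open>A small determinant forces \<open>k\<close> close to both \<open>B\<close> and
    \<open>B'\<close>: the gap \<open>B + B' - 2 * Re k\<close> is at most \<open>\<delta>\<close>,
    and it controls the distance from \<open>k\<close> to either number.\<close>
  have near: "cmod (k - of_real b) \<le> sqrt (M * \<delta>)" if "b = B \<or> b = B'" for b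
  proof -
    have b: "0 \<le> b" "b \<le> M" "B * B' = b * (B + B' - b)"
      using that B B' by (auto simp: algebra_simps)
    have "(cmod (k - of_real b))\<^sup>2 = (cmod k)\<^sup>2 - 2 * b * Re k + b\<^sup>2"
      by (simp add: cmod_power2 power2_diff)
    also have "\<dots> \<le> b * (B + B' - 2 * Re k)"
      using k b(3) by (simp add: algebra_simps power2_eq_square)
    also have "\<dots> \<le> M * \<delta>"
      using b Re_le Rek by (intro mult_mono) auto
    finally show ?thesis
      by (rule real_le_rsqrt)
  qed
  define \<eta> where "\<eta> = of_real B - k"
  have \<eta>: "cmod \<eta> \<le> sqrt (M * \<delta>)"
    using near[of B] by (simp add: \<eta>_def norm_minus_commute)
  have "cmod (of_real B' - of_real B) \<le> cmod (k - of_real B) + cmod (k - of_real B')"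
    using norm_triangle_ineq4[of "k - of_real B" "k - of_real B'"] by simp
  then have BB': "\<bar>B' - B\<bar> \<le> 2 * sqrt (M * \<delta>)"
    using near[of B] near[of B'] by (simp flip: of_real_diff)
  have D2: "(cmod D)\<^sup>2 = ?U * ?U' + ?x"
    unfolding D_def by (rule norm_one_minus_mult_cnj)
  have ReD: "2 * Re D = ?U + ?U' + ?x"
    unfolding D_def cmod_power2 by (simp add: algebra_simps power2_eq_square)
  \<comment> \<open>For \<open>g w = w * \<psi> w\<close>, the hypothesis \<open>eq\<close> says
    that \<open>g u * cnj (g u')\<close> has modulus \<open>cmod (g u) * cmod (g u')\<close>.
    Expanded around \<open>k = B = B'\<close>, it leaves \<open>B * ?x\<close> as the main term, up
    to errors controlled by \<open>\<delta>\<close>.\<close>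
  have key: "\<delta> * (?U * ?U') = (2 * Re k + (cmod k)\<^sup>2 - B) * ?x + (B' - B) * ?U' + 2 * Re (\<eta> * D)"
  proof -
    have 1: "(cmod (1 - (1 + k) * D))\<^sup>2 = 1 - 2 * Re D - 2 * Re (k * D) + (cmod (1 + k))\<^sup>2 * (cmod D)\<^sup>2"
      unfolding cmod_power2 by (simp add: algebra_simps power2_eq_square)
    have 2: "2 * Re (k * D) = B * (2 * Re D) - 2 * Re (\<eta> * D)"
      by (simp add: \<eta>_def algebra_simps)
    have "(1 - (1 + B) * ?U) * (1 - (1 + B') * ?U') = 
       1 - (?U + ?U' + ?x) - (B * (?U + ?U' + ?x) - 2 * Re (\<eta> * D)) + (cmod (1 + k))\<^sup>2 * (?U * ?U' + ?x)"
      unfolding eq 1 2 ReD D2 by simp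
    then show ?thesis
      unfolding \<delta>_def k2 by algebra
  qed
  have U01: "0 \<le> ?U" "?U \<le> 1" "0 \<le> ?U'" "?U' \<le> 1"
    using defect_pos[OF u] defect_pos[OF u'] by auto
  have x4: "?x \<le> 4"
  proof -
    have "cmod (u - u') \<le> 2"
      using norm_triangle_ineq4[of u u'] u u' by simp
    then show ?thesis
      using power_mono[of "cmod (u - u')" 2 2] by simp
  qed
  have Dle: "cmod D \<le> 2"
    using norm_triangle_ineq4[of 1 "u * cnj u'"] norm_mult_less[of u 1 "cnj u'" 1] u u' 
    unfolding D_def by simp
  have a: "\<delta> * (?U * ?U') \<le> \<delta>"
    using \<delta>0 U01 by (simp add: mult_left_le mult_le_one)
  have b: "- (B' - B) * ?U' \<le> 2 * sqrt (M * \<delta>)"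
  proof -
    have "- (B' - B) * ?U' \<le> \<bar>B' - B\<bar> * 1"
      using U01 by (intro mult_mono) auto
    then show ?thesis
      using BB' by simp
  qed
  have "\<bar>Re (\<eta> * D)\<bar> \<le> cmod \<eta> * cmod D"
    using abs_Re_le_cmod[of "\<eta> * D"] by (simp add: norm_mult)
  also have "\<dots> \<le> sqrt (M * \<delta>) * 2"
    using \<eta> Dle by (intro mult_mono) (auto simp: M\<delta>)
  finally have c: "\<bar>Re (\<eta> * D)\<bar> \<le> 2 * sqrt (M * \<delta>)"
    by simp
  have d: "(B - 2 * sqrt (M * \<delta>)) * ?x \<le> (2 * Re k + (cmod k)\<^sup>2 - B) * ?x"
  proof (rule mult_right_mono)
    have "\<bar>Re \<eta>\<bar> \<le> sqrt (M * \<delta>)"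
      using abs_Re_le_cmod[of \<eta>] \<eta> by linarith
    then have "B - sqrt (M * \<delta>) \<le> Re k"
      unfolding \<eta>_def by simp
    then show "B - 2 * sqrt (M * \<delta>) \<le> 2 * Re k + (cmod k)\<^sup>2 - B"
      using zero_le_power2[of "cmod k"] by linarith
  qed simp
  \<comment> \<open>The constant 14 is the sum of 8 from \<open>d\<close> and \<open>x4\<close>, 2
    from \<open>b\<close>, and 4 from \<open>c\<close>.\<close>
  have "2 * sqrt (M * \<delta>) * ?x \<le> 2 * sqrt (M * \<delta>) * 4"
    using x4 M\<delta> by (intro mult_left_mono) auto
  then show "B * ?x \<le> \<delta> + 14 * sqrt (M * \<delta>)"
    using a b c d key by (simp add: algebra_simps)
qed

text \<open>Normalising \<open>\<phi>\<close> to fix the origin gives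
  \<open>g w = w * \<psi> w\<close>. Either \<open>\<psi>\<close> stays in the open disc, or
  equality in the Schwarz lemma makes \<open>g\<close> a rotation and \<open>\<phi>\<close> an
  automorphism.\<close>

lemma self_map_of_disc_cases:
  assumes \<phi>: "self_map_of_disc \<phi>"
  obtains c p where "cmod c = 1" "cmod p < 1"
      "\<And>w. cmod w < 1 \<Longrightarrow> \<phi> w = (c * w + p) / (1 + cnj p * c * w)"
  | \<psi> p where "self_map_of_disc \<psi>" "cmod p < 1"
      "\<And>w. cmod w < 1 \<Longrightarrow> Moebius_function 0 p (\<phi> w) = w * \<psi> w"
proof -
  let ?p = "\<phi> 0"
  have p: "cmod ?p < 1"
    using self_map_of_disc_norm[OF \<phi>, of 0] by simp
  define g where "g = Moebius_function 0 ?p \<circ> \<phi>"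
  have g: "self_map_of_disc g"
    unfolding g_def using self_map_of_disc_compose[OF self_map_of_disc_Moebius[OF p] \<phi>] .
  have g0: "g 0 = 0"
    by (simp add: g_def Moebius_function_eq_zero)
  have holg: "g holomorphic_on ball 0 1"
    using g by (simp add: self_map_of_disc_def)
  note Schwarz = Schwarz_Lemma[OF holg g0 self_map_of_disc_norm[OF g]]
  obtain \<psi> where \<psi>: "\<psi> holomorphic_on ball 0 1" "\<And>z. cmod z < 1 \<Longrightarrow> g z = z * \<psi> z" "deriv g 0 = \<psi> 0"
    using Schwarz3[OF holg g0] by blast
  show ?thesis
  proof (cases "\<forall>z. cmod z < 1 \<longrightarrow> cmod (\<psi> z) < 1")
    case True
    then have "self_map_of_disc \<psi>"
      using \<psi>(1) by (auto simp: self_map_of_disc_def)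
    then show ?thesis
      using that(2)[OF _ p] \<psi>(2) by (simp add: g_def)
  next
    case False
    then obtain z where z: "cmod z < 1" "cmod (\<psi> z) \<ge> 1"
      by force
    \<comment> \<open>The equality case of the Schwarz lemma is reached through the derivative if
      \<open>z = 0\<close>, and through the modulus of \<open>g z\<close> otherwise.\<close>
    have "\<exists>\<alpha>. (\<forall>z. cmod z < 1 \<longrightarrow> g z = \<alpha> * z) \<and> cmod \<alpha> = 1"
    proof (cases "z = 0")
      case True
      then show ?thesis
        using Schwarz(2,3)[of 0] \<psi>(3) z by force
    next
      case False
      have "cmod z \<le> cmod (g z)"
        using \<psi>(2)[OF z(1)] z mult_left_mono[OF z(2), of "cmod z"] by (simp add: norm_mult)
      then show ?thesis
        using Schwarz(1,3)[of z] z False by force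
    qed
    then obtain c where c: "\<And>z. cmod z < 1 \<Longrightarrow> g z = c * z" "cmod c = 1"
      by blast
    show ?thesis
    proof (rule that(1)[OF c(2) p])
      fix w :: complex assume w: "cmod w < 1"
      have \<phi>w: "cmod (\<phi> w) < 1"
        using self_map_of_disc_norm[OF \<phi> w] .
      have "\<phi> w = Moebius_function 0 (- ?p) (g w)"
        using Moebius_function_compose[of "- ?p" ?p "\<phi> w"] p \<phi>w by (simp add: g_def)
      then show "\<phi> w = (c * w + ?p) / (1 + cnj ?p * c * w)"
        using c(1)[OF w] by (simp add: Moebius_function_simple mult.assoc)
    qed
  qed
qed

text \<open>The defect bounds involving \<open>M\<close> keep the Pick matrix bounded; without them \<open>\<eta>\<close> could not be
  chosen independently of how close \<open>u\<close> and \<open>u'\<close> are to the unit circle.\<close>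

lemma Schwarz_Pick_uniformly_strict:
  assumes \<phi>: "self_map_of_disc \<phi>" and \<psi>: "self_map_of_disc \<psi>" and p: "cmod p < 1"
    and \<phi>\<psi>: "\<And>w. cmod w < 1 \<Longrightarrow> Moebius_function 0 p (\<phi> w) = w * \<psi> w"
    and M: "0 \<le> M" and \<epsilon>: "0 < \<epsilon>"
  obtains \<eta> where "0 < \<eta>" "\<eta> \<le> 1"
    "\<And>u u'. \<lbrakk>cmod u < 1; cmod u' < 1; \<epsilon> \<le> cmod (u - u');
       1 - (cmod (\<phi> u))\<^sup>2 \<le> M * (1 - (cmod u)\<^sup>2); 1 - (cmod (\<phi> u'))\<^sup>2 \<le> M * (1 - (cmod u')\<^sup>2)\<rbrakk>
       \<Longrightarrow> sinh_sq (\<phi> u) (\<phi> u') \<le> (1 - \<eta>) * sinh_sq u u'"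
proof -
  obtain c where c: "c > 0" "\<And>u. cmod u < 1 \<Longrightarrow> c * (1 - (cmod u)\<^sup>2) \<le> 1 - (cmod (\<psi> u))\<^sup>2"
    using self_map_of_disc_defect_ge[OF \<psi>] by blast
  define N where "N = M / (1 - cmod p)\<^sup>2"
  have N: "0 \<le> N"
    using M by (simp add: N_def)
  \<comment> \<open>\<open>L\<close> and \<open>\<delta>0\<close> come from the contradiction in
    \<open>\<delta>_ge\<close>: a determinant \<open>\<delta>\<close> below 1 satisfies
    \<open>\<delta> \<le> sqrt \<delta>\<close>, so the deficit bounds give
    \<open>c * \<epsilon> ^ 4 \<le> L * sqrt \<delta>\<close>.\<close>
  define L where "L = 4 * (1 + 14 * sqrt N)"
  have L: "L > 0"
    using N by (simp add: L_def add_pos_nonneg)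
  define \<delta>0 where "\<delta>0 = min 1 ((c * \<epsilon> ^ 4 / L)\<^sup>2)"
  have \<delta>0: "0 < \<delta>0" "\<delta>0 \<le> 1"
    using c(1) \<epsilon> L by (auto simp: \<delta>0_def)
  \<comment> \<open>The divisor bounds the product of the diagonal Pick entries, so that the
    absolute lower bound \<open>\<delta>0\<close> becomes a relative loss.\<close>
  define \<eta> where "\<eta> = \<delta>0 / (1 + N)\<^sup>2"
  have "1 \<le> (1 + N)\<^sup>2"
    using N by (simp add: one_le_power)
  then have "\<delta>0 \<le> (1 + N)\<^sup>2"
    using \<delta>0 by linarith
  then have \<eta>: "0 < \<eta>" "\<eta> \<le> 1"
    using \<delta>0 N unfolding \<eta>_def by (auto simp: divide_le_eq)
  show ?thesis
  proof (rule that[OF \<eta>])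
    fix u u' :: complex
    assume u: "cmod u < 1" and u': "cmod u' < 1" and uu': "\<epsilon> \<le> cmod (u - u')"
      and Mu: "1 - (cmod (\<phi> u))\<^sup>2 \<le> M * (1 - (cmod u)\<^sup>2)"
      and Mu': "1 - (cmod (\<phi> u'))\<^sup>2 \<le> M * (1 - (cmod u')\<^sup>2)"
    define B where "B w = (cmod w)\<^sup>2 * (1 - (cmod (\<psi> w))\<^sup>2) / (1 - (cmod w)\<^sup>2)" for w
    have B_eq: "(1 + B w) * (1 - (cmod w)\<^sup>2) = 1 - (cmod (w * \<psi> w))\<^sup>2" if "cmod w < 1" for w
      using defect_pos[OF that] by (simp add: B_def norm_mult power_mult_distrib field_simps)
    have B_ge: "c * (cmod w)\<^sup>2 \<le> B w" if w: "cmod w < 1" for w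
      using mult_left_mono[OF c(2)[OF w], of "(cmod w)\<^sup>2"] defect_pos[OF w]
      by (simp add: B_def pos_le_divide_eq mult_ac)
    have B0: "0 \<le> B w" if w: "cmod w < 1" for w
      using order_trans[OF _ B_ge[OF w], of 0] c(1) by simp
    have BN: "1 + B w \<le> N" if w: "cmod w < 1" and Mw: "1 - (cmod (\<phi> w))\<^sup>2 \<le> M * (1 - (cmod w)\<^sup>2)" for w
    proof -
      have "(1 + B w) * (1 - (cmod w)\<^sup>2) \<le> (1 - (cmod (\<phi> w))\<^sup>2) / (1 - cmod p)\<^sup>2"
        using Moebius_defect_le[OF p self_map_of_disc_norm[OF \<phi> w]]
        by (simp only: B_eq[OF w] \<phi>\<psi>[OF w])
      also have "\<dots> \<le> M * (1 - (cmod w)\<^sup>2) / (1 - cmod p)\<^sup>2"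
        by (rule divide_right_mono[OF Mw]) simp
      finally have "(1 + B w) * (1 - (cmod w)\<^sup>2) \<le> N * (1 - (cmod w)\<^sup>2)"
        by (simp add: N_def)
      then show ?thesis
        using defect_pos[OF w] by simp
    qed
    define D where "D = 1 - u * cnj u'"
    define k where "k = u * cnj u' * (1 - \<psi> u * cnj (\<psi> u')) / D"
    define \<delta> where "\<delta> = (1 + B u) * (1 + B u') - (cmod (1 + k))\<^sup>2"
    let ?s = "sinh_sq u u'"
    have s: "0 \<le> ?s"
      by (rule sinh_sq_nonneg[OF u u'])
    have D2: "(cmod D)\<^sup>2 = (1 - (cmod u)\<^sup>2) * (1 - (cmod u')\<^sup>2) * (1 + ?s)"
      unfolding D_def by (rule norm_one_minus_mult_cnj_sinh_sq[OF u u'])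
    have D2pos: "0 < (cmod D)\<^sup>2"
      unfolding D2 using defect_pos[OF u] defect_pos[OF u'] s by simp
    then have D0: "D \<noteq> 0"
      by auto
    have \<psi>u: "cmod (\<psi> u) < 1" "cmod (\<psi> u') < 1"
      using self_map_of_disc_norm[OF \<psi>] u u' by auto
    \<comment> \<open>This is the Schwarz-Pick inequality for \<open>\<psi>\<close>: the matrix with
      diagonal \<open>B u\<close>, \<open>B u'\<close> and off-diagonal entry \<open>k\<close> is
      positive semidefinite.\<close>
    have kB: "(cmod k)\<^sup>2 \<le> B u * B u'"
    proof -
      have "(cmod (1 - \<psi> u * cnj (\<psi> u')))\<^sup>2 \<le> (1 - (cmod (\<psi> u))\<^sup>2) * (1 - (cmod (\<psi> u'))\<^sup>2) * (1 + ?s)"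
        unfolding norm_one_minus_mult_cnj_sinh_sq[OF \<psi>u]
        using Schwarz_Pick[OF \<psi> u u'] defect_pos[OF \<psi>u(1)] defect_pos[OF \<psi>u(2)] by simp
      then have "(cmod k)\<^sup>2 \<le>
          (cmod u)\<^sup>2 * (cmod u')\<^sup>2 * ((1 - (cmod (\<psi> u))\<^sup>2) * (1 - (cmod (\<psi> u'))\<^sup>2) * (1 + ?s)) / (cmod D)\<^sup>2"
        unfolding k_def norm_divide norm_mult power_divide power_mult_distrib complex_mod_cnj
        by (intro divide_right_mono mult_left_mono) auto
      also have "\<dots> = B u * B u'"
        unfolding D2 B_def using s by simp
      finally show ?thesis .
    qed
    have kD: "1 - (1 + k) * D = (u * \<psi> u) * cnj (u' * \<psi> u')"
      using D0 unfolding k_def by (simp add: field_simps) (simp add: D_def algebra_simps)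
    have eq: "(1 - (1 + B u) * (1 - (cmod u)\<^sup>2)) * (1 - (1 + B u') * (1 - (cmod u')\<^sup>2)) =
             (cmod (1 - (1 + k) * (1 - u * cnj u')))\<^sup>2"
      unfolding B_eq[OF u] B_eq[OF u'] kD[unfolded D_def] norm_mult complex_mod_cnj
      by (simp add: power_mult_distrib)
    have BuN: "B u \<le> N" "B u' \<le> N"
      using BN[OF u Mu] BN[OF u' Mu'] by auto
    have 1: "B u * (cmod (u - u'))\<^sup>2 \<le> \<delta> + 14 * sqrt (N * \<delta>)" and \<delta>: "0 \<le> \<delta>"
      using Schwarz_Pick_deficit[OF u u' B0[OF u] BuN(1) B0[OF u'] BuN(2) kB eq] unfolding \<delta>_def by auto
    \<comment> \<open>Interchanging the points conjugates \<open>k\<close> and gives the deficit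
      bound for \<open>B u'\<close>. Both bounds are used, since either point may be the origin,
      where \<open>B\<close> vanishes; by the parallelogram law two points at distance
      \<open>\<epsilon>\<close> cannot both be close to it.\<close>
    have eq': "(1 - (1 + B u') * (1 - (cmod u')\<^sup>2)) * (1 - (1 + B u) * (1 - (cmod u)\<^sup>2)) =
             (cmod (1 - (1 + cnj k) * (1 - u' * cnj u)))\<^sup>2"
      using eq complex_mod_cnj[of "1 - (1 + k) * (1 - u * cnj u')"] by (simp add: mult.commute)
    have \<delta>': "\<delta> = (1 + B u') * (1 + B u) - (cmod (1 + cnj k))\<^sup>2"
      unfolding \<delta>_def using complex_mod_cnj[of "1 + k"] by (simp add: mult.commute)
    have kB': "(cmod (cnj k))\<^sup>2 \<le> B u' * B u"
      using kB by (simp add: mult.commute)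
    have 2: "B u' * (cmod (u - u'))\<^sup>2 \<le> \<delta> + 14 * sqrt (N * \<delta>)"
      using Schwarz_Pick_deficit(1)[OF u' u B0[OF u'] BuN(2) B0[OF u] BuN(1) kB' eq'] 
      unfolding \<delta>'[symmetric] by (simp add: norm_minus_commute)
    have \<delta>_ge: "\<delta>0 \<le> \<delta>"
    proof (rule ccontr)
      assume "\<not> \<delta>0 \<le> \<delta>"
      then have lt: "\<delta> < \<delta>0" by simp
      then have "\<delta> \<le> 1"
        using \<delta>0 by simp
      then have "\<delta> * \<delta> \<le> \<delta>"
        using \<delta> by (simp add: mult_left_le)
      then have sq: "\<delta> \<le> sqrt \<delta>"
        by (intro real_le_rsqrt) (simp add: power2_eq_square)
      have "\<epsilon> ^ 4 \<le> cmod (u - u') ^ 4"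
        using \<epsilon> uu' by (intro power_mono) auto
      then have "c * \<epsilon> ^ 4 \<le> c * (cmod (u - u'))\<^sup>2 * (cmod (u - u'))\<^sup>2"
        using c(1) by (simp add: power4_eq_xxxx power2_eq_square mult_ac)
      also have "\<dots> \<le> (2 * B u + 2 * B u') * (cmod (u - u'))\<^sup>2"
      proof (rule mult_right_mono)
        have "(cmod (u - u'))\<^sup>2 + (cmod (u + u'))\<^sup>2 = 2 * (cmod u)\<^sup>2 + 2 * (cmod u')\<^sup>2"
          unfolding cmod_power2 by (simp add: algebra_simps power2_eq_square)
        then have "(cmod (u - u'))\<^sup>2 \<le> 2 * (cmod u)\<^sup>2 + 2 * (cmod u')\<^sup>2"
          using zero_le_power2[of "cmod (u + u')"] by linarith
        then have "c * (cmod (u - u'))\<^sup>2 \<le> c * (2 * (cmod u)\<^sup>2 + 2 * (cmod u')\<^sup>2)"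
          using c(1) by simp
        then show "c * (cmod (u - u'))\<^sup>2 \<le> 2 * B u + 2 * B u'"
          using B_ge[OF u] B_ge[OF u'] by (simp add: algebra_simps)
      qed simp
      also have "\<dots> \<le> 4 * (\<delta> + 14 * sqrt (N * \<delta>))"
        using 1 2 by (simp add: algebra_simps)
      also have "\<dots> \<le> L * sqrt \<delta>"
        unfolding L_def real_sqrt_mult using sq by (simp add: algebra_simps)
      finally have "c * \<epsilon> ^ 4 / L \<le> sqrt \<delta>"
        using L by (simp add: field_simps)
      then have "(c * \<epsilon> ^ 4 / L)\<^sup>2 \<le> (sqrt \<delta>)\<^sup>2"
        using L c(1) by (intro power_mono) auto
      then show False
        using lt \<delta> by (simp add: \<delta>0_def)
    qed
    let ?pg = "sinh_sq (\<phi> u) (\<phi> u')" and ?AA = "(1 + B u) * (1 + B u')"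
    have g: "cmod (u * \<psi> u) < 1" "cmod (u' * \<psi> u') < 1"
      using Moebius_function_norm_lt_1[OF p self_map_of_disc_norm[OF \<phi>]] \<phi>\<psi> u u' by metis+
    have "?pg = sinh_sq (u * \<psi> u) (u' * \<psi> u')"
      using sinh_sq_Moebius[OF p self_map_of_disc_norm[OF \<phi> u] self_map_of_disc_norm[OF \<phi> u']]
        \<phi>\<psi> u u' by simp
    then have "(cmod (1 - (u * \<psi> u) * cnj (u' * \<psi> u')))\<^sup>2 =
        (1 + B u) * (1 - (cmod u)\<^sup>2) * ((1 + B u') * (1 - (cmod u')\<^sup>2)) * (1 + ?pg)"
      unfolding norm_one_minus_mult_cnj_sinh_sq[OF g] B_eq[OF u] B_eq[OF u'] by simp
    moreover have "1 - (u * \<psi> u) * cnj (u' * \<psi> u') = (1 + k) * D"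
      unfolding kD[symmetric] by simp
    ultimately have "(cmod (1 + k))\<^sup>2 * ((1 - (cmod u)\<^sup>2) * (1 - (cmod u')\<^sup>2) * (1 + ?s)) =
        ?AA * ((1 - (cmod u)\<^sup>2) * (1 - (cmod u')\<^sup>2)) * (1 + ?pg)"
      by (simp add: norm_mult power_mult_distrib D2 mult_ac)
    then have "(cmod (1 + k))\<^sup>2 * (1 + ?s) = ?AA * (1 + ?pg)"
      using defect_pos[OF u] defect_pos[OF u'] by (simp add: mult_ac)
    \<comment> \<open>The loss in the Schwarz-Pick inequality is expressed exactly by the
      determinant, so its lower bound \<open>\<delta>0\<close> can be inserted.\<close>
    then have *: "?AA * ?pg = ?AA * ?s - \<delta> * (1 + ?s)"
      unfolding \<delta>_def by (simp add: algebra_simps)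
    have "?AA \<le> (1 + N)\<^sup>2"
      unfolding power2_eq_square using BuN B0[OF u] B0[OF u'] by (intro mult_mono) auto
    then have "?AA * \<eta> \<le> (1 + N)\<^sup>2 * \<eta>"
      using \<eta> by (intro mult_right_mono) auto
    also have "\<dots> = \<delta>0"
      using N by (simp add: \<eta>_def)
    finally have "?AA * \<eta> \<le> \<delta>0" .
    then have "?AA * \<eta> * ?s \<le> \<delta> * (1 + ?s)"
      using \<delta>_ge s \<delta> by (intro mult_mono) auto
    then have "?AA * ?pg \<le> ?AA * ((1 - \<eta>) * ?s)"
      using * by (simp add: algebra_simps)
    moreover have "0 < ?AA"
      using B0[OF u] B0[OF u'] by simp
    ultimately show "?pg \<le> (1 - \<eta>) * ?s"
      by (rule mult_left_le_imp_le)
  qed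
qed

section \<open>Uniform continuity of the subordination functions\<close>

text \<open>The cancelled equations are multiplied by \<open>z\<close>, so that the origin needs no
  exception and \<open>u 0 = v 0 = 0\<close> follows. Off the open disc \<open>u\<close> and
  \<open>v\<close> are unconstrained.\<close>

definition subordination_pair ::
    "(complex \<Rightarrow> complex) \<Rightarrow> (complex \<Rightarrow> complex) \<Rightarrow> (complex \<Rightarrow> complex) \<Rightarrow> (complex \<Rightarrow> complex) \<Rightarrow> bool"
  where "subordination_pair \<phi>1 \<phi>2 u v \<longleftrightarrow> (\<forall>z. cmod z < 1 \<longrightarrow>
     cmod (u z) < 1 \<and> cmod (v z) < 1 \<and> v z = z * \<phi>1 (u z) \<and> u z = z * \<phi>2 (v z))"

lemma subordination_pair_sym:
  "subordination_pair \<phi>1 \<phi>2 u v \<Longrightarrow> subordination_pair \<phi>2 \<phi>1 v u"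
  unfolding subordination_pair_def by blast

lemma subordination_pairD:
  assumes "subordination_pair \<phi>1 \<phi>2 u v" "cmod z < 1"
  shows "cmod (u z) < 1" "cmod (v z) < 1" "v z = z * \<phi>1 (u z)" "u z = z * \<phi>2 (v z)"
  using assms unfolding subordination_pair_def by blast+

text \<open>Multiplication by \<open>z\<close> does not decrease a defect, and
  \<open>\<phi>2\<close> decreases it at most by a constant factor. Applied to
  \<open>v z = z * \<phi>1 (u z)\<close> and \<open>u z = z * \<phi>2 (v z)\<close>, this makes the
  defects comparable up to the boundary.\<close>

lemma subordination_pair_defects:
  assumes \<phi>1: "self_map_of_disc \<phi>1" and \<phi>2: "self_map_of_disc \<phi>2"
    and uv: "subordination_pair \<phi>1 \<phi>2 u v"
  obtains C where "C > 0"
    "\<And>z. cmod z < 1 \<Longrightarrow> 1 - (cmod (\<phi>1 (u z)))\<^sup>2 \<le> 1 - (cmod (v z))\<^sup>2"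
    "\<And>z. cmod z < 1 \<Longrightarrow> 1 - (cmod (v z))\<^sup>2 \<le> C * (1 - (cmod (u z))\<^sup>2)"
proof -
  obtain c where c: "c > 0" "\<And>u. cmod u < 1 \<Longrightarrow> c * (1 - (cmod u)\<^sup>2) \<le> 1 - (cmod (\<phi>2 u))\<^sup>2"
    using self_map_of_disc_defect_ge[OF \<phi>2] by blast
  show ?thesis
  proof (rule that[of "1 / c"])
    fix z :: complex assume z: "cmod z < 1"
    note * = subordination_pairD[OF uv z]
    show "1 - (cmod (\<phi>1 (u z)))\<^sup>2 \<le> 1 - (cmod (v z))\<^sup>2"
      using defect_mult_le[of z "\<phi>1 (u z)"] z by (subst *(3)) simp
    have "c * (1 - (cmod (v z))\<^sup>2) \<le> 1 - (cmod (\<phi>2 (v z)))\<^sup>2"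
      by (rule c(2)[OF *(2)])
    also have "\<dots> \<le> 1 - (cmod (u z))\<^sup>2"
      using defect_mult_le[of z "\<phi>2 (v z)"] z by (subst *(4)) simp
    finally show "1 - (cmod (v z))\<^sup>2 \<le> 1 / c * (1 - (cmod (u z))\<^sup>2)"
      using c(1) by (simp add: field_simps)
  qed (use c in auto)
qed

text \<open>Clearing the denominators turns a hyperbolic contraction into a Euclidean Lipschitz
  bound whose factor is governed by a quotient of defects.\<close>

lemma norm_diff_le_if_sinh_sq_le:
  assumes "cmod a < 1" "cmod b < 1" "cmod u < 1" "cmod u' < 1"
    and "sinh_sq a b \<le> t * sinh_sq u u'"
    and "0 \<le> t" "1 - (cmod a)\<^sup>2 \<le> X" "1 - (cmod b)\<^sup>2 \<le> X'"
  shows "cmod (a - b) \<le> sqrt t * sqrt (X * X' / ((1 - (cmod u)\<^sup>2) * (1 - (cmod u')\<^sup>2))) * cmod (u - u')"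
proof -
  let ?A = "(1 - (cmod a)\<^sup>2) * (1 - (cmod b)\<^sup>2)" and ?U = "(1 - (cmod u)\<^sup>2) * (1 - (cmod u')\<^sup>2)"
  have pos: "0 < 1 - (cmod a)\<^sup>2" "0 < 1 - (cmod b)\<^sup>2" "0 < ?U"
    using assms(1-4) by (blast intro: mult_pos_pos defect_pos)+
  have "(cmod (a - b))\<^sup>2 = ?A * sinh_sq a b"
    using pos by (simp add: sinh_sq_def)
  also have "\<dots> \<le> (X * X') * (t * sinh_sq u u')"
    using assms(5-8) pos sinh_sq_nonneg[OF assms(1,2)] by (intro mult_mono) auto
  also have "\<dots> = t * (X * X' / ?U) * (cmod (u - u'))\<^sup>2"
    by (simp add: sinh_sq_def)
  finally have "cmod (a - b) \<le> sqrt (t * (X * X' / ?U) * (cmod (u - u'))\<^sup>2)"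
    by (rule real_le_rsqrt)
  then show ?thesis
    by (simp only: real_sqrt_mult[of _ "(_)\<^sup>2"] real_sqrt_mult[of t] real_sqrt_abs abs_norm_cancel)
qed

text \<open>Comparability of the defects makes \<open>\<phi>1\<close> Lipschitz with constant
  \<open>C\<close> on the values of \<open>u\<close>, and \<open>v z = z * \<phi>1 (u z)\<close>
  inherits the uniform continuity.\<close>

lemma subordination_pair_uniformly_continuous_snd:
  assumes \<phi>1: "self_map_of_disc \<phi>1" and \<phi>2: "self_map_of_disc \<phi>2"
    and uv: "subordination_pair \<phi>1 \<phi>2 u v"
    and u: "uniformly_continuous_on (ball 0 1) u"
  shows "uniformly_continuous_on (ball 0 1) v"
proof -
  obtain C where C: "C > 0"
    "\<And>z. cmod z < 1 \<Longrightarrow> 1 - (cmod (\<phi>1 (u z)))\<^sup>2 \<le> 1 - (cmod (v z))\<^sup>2"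
    "\<And>z. cmod z < 1 \<Longrightarrow> 1 - (cmod (v z))\<^sup>2 \<le> C * (1 - (cmod (u z))\<^sup>2)"
    using subordination_pair_defects[OF \<phi>1 \<phi>2 uv] by blast
  have le: "dist (v z') (v z) \<le> dist z' z + C * dist (u z') (u z)" if z: "cmod z < 1" "cmod z' < 1" for z z'
  proof -
    have *: "cmod (u z) < 1" "cmod (u z') < 1" "v z = z * \<phi>1 (u z)" "v z' = z' * \<phi>1 (u z')"
      using subordination_pairD[OF uv z(1)] subordination_pairD[OF uv z(2)] by blast+
    have \<phi>: "cmod (\<phi>1 (u z)) < 1" "cmod (\<phi>1 (u z')) < 1"
      using * self_map_of_disc_norm[OF \<phi>1] by auto
    have pos: "0 < 1 - (cmod (u z))\<^sup>2" "0 < 1 - (cmod (u z'))\<^sup>2"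
      using * defect_pos by auto
    have "cmod (\<phi>1 (u z') - \<phi>1 (u z)) \<le> sqrt 1 * sqrt (C * (1 - (cmod (u z'))\<^sup>2) * (C * (1 - (cmod (u z))\<^sup>2)) /
        ((1 - (cmod (u z'))\<^sup>2) * (1 - (cmod (u z))\<^sup>2))) * cmod (u z' - u z)"
      using Schwarz_Pick[OF \<phi>1 *(2,1)] C(2,3)[OF z(1)] C(2,3)[OF z(2)]
      by (intro norm_diff_le_if_sinh_sq_le \<phi> *) linarith+
    also have "C * (1 - (cmod (u z'))\<^sup>2) * (C * (1 - (cmod (u z))\<^sup>2)) /
        ((1 - (cmod (u z'))\<^sup>2) * (1 - (cmod (u z))\<^sup>2)) = C\<^sup>2"
      using pos by (simp add: power2_eq_square)
    finally have 1: "cmod (\<phi>1 (u z') - \<phi>1 (u z)) \<le> C * cmod (u z' - u z)"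
      using C(1) by simp
    have "v z' - v z = (z' - z) * \<phi>1 (u z') + z * (\<phi>1 (u z') - \<phi>1 (u z))"
      unfolding * by (simp add: algebra_simps)
    then have "cmod (v z' - v z) \<le> cmod (z' - z) * cmod (\<phi>1 (u z')) + cmod z * cmod (\<phi>1 (u z') - \<phi>1 (u z))"
      using norm_triangle_ineq by (metis norm_mult)
    also have "\<dots> \<le> cmod (z' - z) * 1 + 1 * (C * cmod (u z' - u z))"
      using 1 \<phi> z by (intro add_mono mult_mono) auto
    finally show ?thesis
      by (simp add: dist_norm)
  qed
  show ?thesis
    unfolding uniformly_continuous_on_def
  proof (intro allI impI)
    fix e :: real assume e: "e > 0"
    then obtain d where d: "d > 0" "\<And>z z'. \<lbrakk>z \<in> ball 0 1; z' \<in> ball 0 1; dist z' z < d\<rbrakk> \<Longrightarrow> dist (u z') (u z) < e / (2 * C)"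
      using u C(1) unfolding uniformly_continuous_on_def by (metis divide_pos_pos mult_pos_pos zero_less_numeral)
    show "\<exists>d>0. \<forall>z\<in>ball 0 1. \<forall>z'\<in>ball 0 1. dist z' z < d \<longrightarrow> dist (v z') (v z) < e"
    proof (intro exI[of _ "min d (e / 2)"] conjI ballI impI)
      fix z z' :: complex assume z: "z \<in> ball 0 1" "z' \<in> ball 0 1" "dist z' z < min d (e / 2)"
      then have "C * dist (u z') (u z) < e / 2"
        using d(2)[of z z'] C(1) by (simp add: field_simps)
      then show "dist (v z') (v z) < e"
        using le[of z z'] z by simp
    qed (use d(1) e in simp)
  qed
qed

text \<open>If two values of \<open>u\<close> are \<open>\<epsilon>\<close> apart, passing from
  \<open>u\<close> to \<open>v\<close> by \<open>\<phi>1\<close> and back by \<open>\<phi>2\<close>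
  contracts their distance by a fixed factor below 1, up to an error proportional to the distance of
  the arguments. Hence the arguments cannot be too close.\<close>

lemma subordination_pair_uniformly_continuous_fst:
  assumes \<phi>1: "self_map_of_disc \<phi>1" and \<phi>2: "self_map_of_disc \<phi>2"
    and uv: "subordination_pair \<phi>1 \<phi>2 u v"
    and \<psi>: "self_map_of_disc \<psi>" "cmod p < 1" "\<And>w. cmod w < 1 \<Longrightarrow> Moebius_function 0 p (\<phi>1 w) = w * \<psi> w"
  shows "uniformly_continuous_on (ball 0 1) u"
proof -
  obtain C where C: "C > 0"
    "\<And>z. cmod z < 1 \<Longrightarrow> 1 - (cmod (\<phi>1 (u z)))\<^sup>2 \<le> 1 - (cmod (v z))\<^sup>2"
    "\<And>z. cmod z < 1 \<Longrightarrow> 1 - (cmod (v z))\<^sup>2 \<le> C * (1 - (cmod (u z))\<^sup>2)"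
    using subordination_pair_defects[OF \<phi>1 \<phi>2 uv] by blast
  obtain C' where C': "C' > 0"
    "\<And>z. cmod z < 1 \<Longrightarrow> 1 - (cmod (\<phi>2 (v z)))\<^sup>2 \<le> 1 - (cmod (u z))\<^sup>2"
    "\<And>z. cmod z < 1 \<Longrightarrow> 1 - (cmod (u z))\<^sup>2 \<le> C' * (1 - (cmod (v z))\<^sup>2)"
    using subordination_pair_defects[OF \<phi>2 \<phi>1 subordination_pair_sym[OF uv]] by blast
  show ?thesis
    unfolding uniformly_continuous_on_def
  proof (intro allI impI)
    fix \<epsilon> :: real assume \<epsilon>: "\<epsilon> > 0"
    obtain \<eta> where \<eta>: "0 < \<eta>" "\<eta> \<le> 1"
      "\<And>u u'. \<lbrakk>cmod u < 1; cmod u' < 1; \<epsilon> \<le> cmod (u - u');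
       1 - (cmod (\<phi>1 u))\<^sup>2 \<le> C * (1 - (cmod u)\<^sup>2); 1 - (cmod (\<phi>1 u'))\<^sup>2 \<le> C * (1 - (cmod u')\<^sup>2)\<rbrakk>
       \<Longrightarrow> sinh_sq (\<phi>1 u) (\<phi>1 u') \<le> (1 - \<eta>) * sinh_sq u u'"
    proof -
      show thesis
        by (rule Schwarz_Pick_uniformly_strict[OF \<phi>1 \<psi> less_imp_le[OF C(1)] \<epsilon>]) (assumption, rule that)
    qed
    let ?t = "sqrt (1 - \<eta>)"
    have t: "0 \<le> ?t" "?t < 1"
      using \<eta> by auto
    show "\<exists>d>0. \<forall>z\<in>ball 0 1. \<forall>z'\<in>ball 0 1. dist z' z < d \<longrightarrow> dist (u z') (u z) < \<epsilon>"
    \<comment> \<open>The witness is read off from \<open>(1 - ?t) * ?x \<le> (C' + 1) * ?e\<close>,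
      obtained below, together with \<open>\<epsilon> \<le> ?x\<close>.\<close>
    proof (intro exI[of _ "(1 - ?t) * \<epsilon> / (C' + 1)"] conjI ballI impI, goal_cases)
      case 1
      show ?case using t \<epsilon> C'(1) by simp
    next
      case (2 z z')
      show ?case
      proof (rule ccontr)
        assume "\<not> dist (u z') (u z) < \<epsilon>"
        then have ge: "\<epsilon> \<le> cmod (u z' - u z)"
          by (simp add: dist_norm)
        have z: "cmod z < 1" "cmod z' < 1"
          using 2 by auto
        have *: "cmod (u z) < 1" "cmod (u z') < 1" "v z = z * \<phi>1 (u z)" "v z' = z' * \<phi>1 (u z')"
          "cmod (v z) < 1" "cmod (v z') < 1" "u z = z * \<phi>2 (v z)" "u z' = z' * \<phi>2 (v z')"
          using subordination_pairD[OF uv z(1)] subordination_pairD[OF uv z(2)] by blast+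
        have \<phi>: "cmod (\<phi>1 (u z)) < 1" "cmod (\<phi>1 (u z')) < 1" "cmod (\<phi>2 (v z)) < 1" "cmod (\<phi>2 (v z')) < 1"
          using self_map_of_disc_norm[OF \<phi>1] self_map_of_disc_norm[OF \<phi>2] *(1,2,5,6) by blast+
        let ?U = "(1 - (cmod (u z'))\<^sup>2) * (1 - (cmod (u z))\<^sup>2)"
        let ?V = "(1 - (cmod (v z'))\<^sup>2) * (1 - (cmod (v z))\<^sup>2)"
        let ?x = "cmod (u z' - u z)" and ?y = "cmod (v z' - v z)" and ?e = "cmod (z' - z)"
        let ?R = "sqrt (?U / ?V)"
        have pos: "0 < ?U" "0 < ?V"
          using * by (blast intro: mult_pos_pos defect_pos)+
        have inv: "sqrt (a / b) * sqrt (b / a) = 1" if "0 < a" "0 < b" for a b :: real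
          using that by (simp flip: real_sqrt_mult)
        have R: "0 < ?R"
          using pos by simp
        have "?U \<le> (C' * (1 - (cmod (v z'))\<^sup>2)) * (C' * (1 - (cmod (v z))\<^sup>2))"
          using C'(1) C'(3)[OF z(1)] C'(3)[OF z(2)] *(1,2,5,6)
          by (intro mult_mono mult_nonneg_nonneg less_imp_le[OF defect_pos] less_imp_le[OF C'(1)])
        then have "?U / ?V \<le> C'\<^sup>2"
          using pos by (simp add: field_simps power2_eq_square)
        then have RC': "?R \<le> C'"
          using C'(1) by (intro real_le_lsqrt) auto
        have "sinh_sq (\<phi>1 (u z')) (\<phi>1 (u z)) \<le> (1 - \<eta>) * sinh_sq (u z') (u z)"
          using C(2,3)[OF z(1)] C(2,3)[OF z(2)] by (intro \<eta>(3) * ge) linarith+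
        \<comment> \<open>The defects of the values of \<open>\<phi>1\<close> are bounded by those
          of \<open>v\<close>, not by multiples of those of \<open>u\<close>. The factor
          \<open>sqrt (?V / ?U)\<close> is then exactly reciprocal to the factor \<open>?R\<close>
          for \<open>\<phi>2\<close>, and only \<open>?t\<close> remains of their product.\<close>
        then have 1: "cmod (\<phi>1 (u z') - \<phi>1 (u z)) \<le> ?t * sqrt (?V / ?U) * ?x"
          using C(2)[OF z(1)] C(2)[OF z(2)] \<eta>(2)
          by (intro norm_diff_le_if_sinh_sq_le \<phi> *) linarith+
        have 2: "cmod (\<phi>2 (v z') - \<phi>2 (v z)) \<le> sqrt 1 * ?R * ?y"
          using Schwarz_Pick[OF \<phi>2 *(6,5)] C'(2)[OF z(1)] C'(2)[OF z(2)]
          by (intro norm_diff_le_if_sinh_sq_le \<phi> *) linarith+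
        have step: "cmod (z' * a' - z * a) \<le> ?e + cmod (a' - a)" if "cmod a' < 1" for a a'
        proof -
          have "z' * a' - z * a = (z' - z) * a' + z * (a' - a)"
            by (simp add: algebra_simps)
          then have "cmod (z' * a' - z * a) \<le> ?e * cmod a' + cmod z * cmod (a' - a)"
            using norm_triangle_ineq by (metis norm_mult)
          also have "\<dots> \<le> ?e * 1 + 1 * cmod (a' - a)"
            using z that by (intro add_mono mult_mono) auto
          finally show ?thesis by simp
        qed
        have "?y \<le> ?e + ?t * sqrt (?V / ?U) * ?x"
          using step[OF \<phi>(2), of "\<phi>1 (u z)"] 1 *(3,4) by simp
        then have "?R * ?y \<le> ?R * (?e + ?t * sqrt (?V / ?U) * ?x)"
          using R by (intro mult_left_mono) auto
        also have "\<dots> = ?R * ?e + (?R * sqrt (?V / ?U)) * ?t * ?x"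
          by (simp only: distrib_left mult_ac)
        also have "?R * sqrt (?V / ?U) = 1"
          by (rule inv[OF pos])
        also have "?R * ?e \<le> C' * ?e"
          using RC' by (rule mult_right_mono) simp
        finally have "?R * ?y \<le> C' * ?e + ?t * ?x"
          by simp
        moreover have "?x \<le> ?e + ?R * ?y"
          using step[OF \<phi>(4), of "\<phi>2 (v z)"] 2 *(7,8) by simp
        ultimately have "(1 - ?t) * ?x \<le> (C' + 1) * ?e"
          by (simp add: algebra_simps)
        moreover have "(1 - ?t) * \<epsilon> \<le> (1 - ?t) * ?x"
          using t ge by (intro mult_left_mono) auto
        ultimately have "(1 - ?t) * \<epsilon> / (C' + 1) \<le> dist z' z"
          using C'(1) by (simp add: field_simps dist_norm)
        then show False
          using \<open>dist z' z < (1 - ?t) * \<epsilon> / (C' + 1)\<close> by linarith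
      qed
    qed
  qed
qed

text \<open>Cluster sets at boundary points are connected, so a finite one is a single point. A
  failure of uniform continuity would produce infinitely many cluster values at one boundary
  point.\<close>

lemma uniformly_continuous_on_ball_if_finite_cluster_sets:
  fixes f :: "complex \<Rightarrow> complex"
  assumes cont: "continuous_on (ball 0 1) f" and bdd: "bounded (f ` ball 0 1)"
    and fin: "\<And>\<zeta>. cmod \<zeta> = 1 \<Longrightarrow> \<exists>F. finite F \<and>
      (\<forall>\<sigma> q. (\<forall>n. \<sigma> n \<in> ball 0 1) \<longrightarrow> \<sigma> \<longlonglongrightarrow> \<zeta> \<longrightarrow> (\<lambda>n. f (\<sigma> n)) \<longlonglongrightarrow> q \<longrightarrow> q \<in> F)"
  shows "uniformly_continuous_on (ball 0 1) f"
proof (rule ccontr)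
  assume "\<not> uniformly_continuous_on (ball 0 1) f"
  then obtain \<epsilon> where \<epsilon>: "\<epsilon> > 0"
    and "\<forall>d>0. \<exists>x\<in>ball 0 1. \<exists>y\<in>ball 0 1. dist y x < d \<and> \<not> dist (f y) (f x) < \<epsilon>"
    unfolding uniformly_continuous_on_def by blast
  then have "\<exists>x y. x \<in> ball 0 1 \<and> y \<in> ball 0 1 \<and> dist y x < inverse (real (Suc n)) \<and> \<epsilon> \<le> dist (f y) (f x)" for n
    by (metis inverse_positive_iff_positive linorder_not_less of_nat_0_less_iff zero_less_Suc)
  then obtain X Y where XY: "\<And>n. X n \<in> ball 0 1" "\<And>n. Y n \<in> ball 0 1"
      "\<And>n. dist (Y n) (X n) < inverse (real (Suc n))" "\<And>n. \<epsilon> \<le> dist (f (Y n)) (f (X n))"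
    by metis
  \<comment> \<open>Compactness of the product gives one subsequence along which the points and
    their values converge together.\<close>
  let ?K = "cball (0 :: complex) 1 \<times> closure (f ` ball 0 1)"
  have "compact ?K"
    using bdd by (simp add: compact_Times compact_closure)
  moreover have "(X n, f (X n)) \<in> ?K" for n
    using XY(1)[of n] closure_subset by fastforce
  ultimately have "\<exists>l\<in>?K. \<exists>r. strict_mono r \<and> ((\<lambda>n. (X n, f (X n))) \<circ> r) \<longlonglongrightarrow> l"
    by (rule compact_def[THEN iffD1, rule_format])
  then obtain l r where lr: "l \<in> ?K" "strict_mono r" "((\<lambda>n. (X n, f (X n))) \<circ> r) \<longlonglongrightarrow> l"
    by blast
  obtain \<zeta> p where l: "l = (\<zeta>, p)" by fastforce
  have X\<zeta>: "(\<lambda>n. X (r n)) \<longlonglongrightarrow> \<zeta>" and fXp: "(\<lambda>n. f (X (r n))) \<longlonglongrightarrow> p"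
    using tendsto_fst[OF lr(3)] tendsto_snd[OF lr(3)] by (simp_all add: l o_def)
  have YX0: "(\<lambda>n. dist (Y (r n)) (X (r n))) \<longlonglongrightarrow> 0"
  proof (rule tendsto_sandwich[OF _ _ tendsto_const])
    show "(\<lambda>n. inverse (real (Suc (r n)))) \<longlonglongrightarrow> 0"
      using LIMSEQ_subseq_LIMSEQ[OF LIMSEQ_inverse_real_of_nat lr(2)] by (simp add: o_def)
  qed (use XY(3) in \<open>auto intro!: always_eventually less_imp_le\<close>)
  have close: "W \<longlonglongrightarrow> \<zeta>" if W: "\<And>n. dist (W n) (X (r n)) \<le> dist (Y (r n)) (X (r n))" for W
  proof -
    have "(\<lambda>n. dist (W n) (X (r n))) \<longlonglongrightarrow> 0"
      by (rule tendsto_sandwich[OF _ _ tendsto_const YX0]) (auto intro!: always_eventually W)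
    then have "(\<lambda>n. W n - X (r n)) \<longlonglongrightarrow> 0"
      by (simp add: dist_norm tendsto_norm_zero_iff)
    from tendsto_add[OF this X\<zeta>] show ?thesis
      by simp
  qed
  show False
  proof (cases "\<zeta> \<in> ball 0 1")
    case True
    then have "isCont f \<zeta>"
      using cont by (simp add: continuous_on_eq_continuous_at)
    then have "(\<lambda>n. f (X (r n))) \<longlonglongrightarrow> f \<zeta>" "(\<lambda>n. f (Y (r n))) \<longlonglongrightarrow> f \<zeta>"
      using isCont_tendsto_compose X\<zeta> close[of "\<lambda>n. Y (r n)"] by blast+
    then have "(\<lambda>n. dist (f (Y (r n))) (f (X (r n)))) \<longlonglongrightarrow> dist (f \<zeta>) (f \<zeta>)"
      by (intro tendsto_dist)
    then have "\<epsilon> \<le> dist (f \<zeta>) (f \<zeta>)"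
      using XY(4) by (intro LIMSEQ_le_const) auto
    then show False
      using \<epsilon> by simp
  next
    case False
    then have "cmod \<zeta> = 1"
      using lr(1) by (simp add: l)
    then obtain F where F: "finite F" "\<And>\<sigma> q. (\<And>n. \<sigma> n \<in> ball 0 1) \<Longrightarrow> \<sigma> \<longlonglongrightarrow> \<zeta> \<Longrightarrow> (\<lambda>n. f (\<sigma> n)) \<longlonglongrightarrow> q \<Longrightarrow> q \<in> F"
      using fin by metis
    \<comment> \<open>By the intermediate value theorem on the segments from \<open>X (r n)\<close> to \<open>Y (r n)\<close>, there is a
      cluster value at every distance less than \<open>\<epsilon>\<close> from \<open>p\<close>.\<close>
    have "{0<..<\<epsilon>} \<subseteq> (\<lambda>q. dist q p) ` F"
    proof
      fix t assume t: "t \<in> {0<..<\<epsilon>}"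
      have "\<exists>w. w \<in> closed_segment (X (r n)) (Y (r n)) \<and> dist (f w) (f (X (r n))) = t" for n
      proof -
        let ?S = "closed_segment (X (r n)) (Y (r n))"
        let ?g = "\<lambda>w. dist (f w) (f (X (r n)))"
        have "?S \<subseteq> ball 0 1"
          using XY(1,2) by (intro closed_segment_subset) auto
        then have "continuous_on ?S ?g"
          by (intro continuous_intros continuous_on_subset[OF cont])
        then have "connected (?g ` ?S)"
          by (rule connected_continuous_image) simp
        moreover have "?g (X (r n)) \<in> ?g ` ?S" "?g (Y (r n)) \<in> ?g ` ?S"
          by (rule image_eqI[where f = ?g, OF refl ends_in_segment(1)],
              rule image_eqI[where f = ?g, OF refl ends_in_segment(2)])
        ultimately have "{?g (X (r n))..?g (Y (r n))} \<subseteq> ?g ` ?S"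
          by (rule connected_contains_Icc)
        moreover have "t \<in> {?g (X (r n))..?g (Y (r n))}"
          using t XY(4)[of "r n"] by auto
        ultimately show ?thesis
          by blast
      qed
      then obtain W where W: "\<And>n. W n \<in> closed_segment (X (r n)) (Y (r n))" "\<And>n. dist (f (W n)) (f (X (r n))) = t"
        by metis
      have Wb: "W n \<in> ball 0 1" for n
        using W(1)[of n] closed_segment_subset[of "X (r n)" "ball 0 1" "Y (r n)"] XY(1,2) by auto
      have W\<zeta>: "W \<longlonglongrightarrow> \<zeta>"
        using segment_bound(1)[OF W(1)] by (intro close) (simp add: dist_norm)
      have "bounded (range (\<lambda>n. f (W n)))"
        using Wb by (intro bounded_subset[OF bdd]) auto
      then obtain q s where qs: "strict_mono s" "((\<lambda>n. f (W n)) \<circ> s) \<longlonglongrightarrow> q"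
        using bounded_imp_convergent_subsequence by blast
      have "q \<in> F"
        using F(2)[of "W \<circ> s" q] Wb LIMSEQ_subseq_LIMSEQ[OF W\<zeta> qs(1)] qs(2) by (simp add: o_def)
      moreover have "(\<lambda>n. dist (f (W (s n))) (f (X (r (s n))))) \<longlonglongrightarrow> dist q p"
        using qs(2) LIMSEQ_subseq_LIMSEQ[OF fXp qs(1)] by (intro tendsto_dist) (simp_all add: o_def)
      then have "dist q p = t"
        using W(2) by (simp add: LIMSEQ_const_iff)
      ultimately show "t \<in> (\<lambda>q. dist q p) ` F"
        by blast
    qed
    then have "finite {0<..<\<epsilon>}"
      using F(1) by (meson finite_imageI finite_subset)
    then show False
      using \<epsilon> by (simp add: infinite_Ioo)
  qed
qed

section \<open>Quadratic equations for the case of two automorphisms\<close>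

lemma finite_quadratic_roots:
  fixes a b c :: "'a :: {idom, ring_char_0}"
  assumes "a \<noteq> 0 \<or> b \<noteq> 0 \<or> c \<noteq> 0"
  shows "finite {w. a * w\<^sup>2 + b * w + c = 0}"
proof -
  have "[:c, b, a:] \<noteq> 0"
    using assms by auto
  then have "finite {w. poly [:c, b, a:] w = 0}"
    by (rule poly_roots_finite)
  then show ?thesis
    by (simp add: algebra_simps power2_eq_square)
qed

text \<open>Passing to the limit along \<open>\<sigma>\<close> makes every cluster value a root of
  the equation with coefficients at \<open>\<zeta>\<close>, which is nontrivial.\<close>

lemma finite_cluster_set_if_quadratic:
  fixes A B C f :: "complex \<Rightarrow> complex"
  assumes "continuous (at \<zeta>) A" "continuous (at \<zeta>) B" "continuous (at \<zeta>) C"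
    and "A \<zeta> \<noteq> 0 \<or> B \<zeta> \<noteq> 0 \<or> C \<zeta> \<noteq> 0"
    and eq: "\<And>z. z \<in> S \<Longrightarrow> A z * (f z)\<^sup>2 + B z * f z + C z = 0"
  shows "\<exists>F. finite F \<and>
      (\<forall>\<sigma> q. (\<forall>n. \<sigma> n \<in> S) \<longrightarrow> \<sigma> \<longlonglongrightarrow> \<zeta> \<longrightarrow> (\<lambda>n. f (\<sigma> n)) \<longlonglongrightarrow> q \<longrightarrow> q \<in> F)"
proof (intro exI conjI allI impI)
  show "finite {w. A \<zeta> * w\<^sup>2 + B \<zeta> * w + C \<zeta> = 0}"
    using assms(4) by (rule finite_quadratic_roots)
  fix \<sigma> q
  assume \<sigma>: "\<forall>n. \<sigma> n \<in> S" "\<sigma> \<longlonglongrightarrow> \<zeta>" "(\<lambda>n. f (\<sigma> n)) \<longlonglongrightarrow> q"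
  have "(\<lambda>n. A (\<sigma> n) * (f (\<sigma> n))\<^sup>2 + B (\<sigma> n) * f (\<sigma> n) + C (\<sigma> n)) \<longlonglongrightarrow> A \<zeta> * q\<^sup>2 + B \<zeta> * q + C \<zeta>"
    by (intro tendsto_intros \<sigma>(3) assms(1-3)[THEN isCont_tendsto_compose, OF \<sigma>(2)])
  then show "q \<in> {w. A \<zeta> * w\<^sup>2 + B \<zeta> * w + C \<zeta> = 0}"
    using eq \<sigma>(1) by (simp add: LIMSEQ_const_iff)
qed

lemma subordination_pair_uniformly_continuous_automorphisms:
  assumes uv: "subordination_pair \<phi>1 \<phi>2 u v" and u: "continuous_on (ball 0 1) u"
    and c: "cmod c = 1" and p: "cmod p < 1"
    and \<phi>1: "\<And>w. cmod w < 1 \<Longrightarrow> \<phi>1 w = (c * w + p) / (1 + cnj p * c * w)"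
    and d: "cmod d = 1" and q: "cmod q < 1"
    and \<phi>2: "\<And>w. cmod w < 1 \<Longrightarrow> \<phi>2 w = (d * w + q) / (1 + cnj q * d * w)"
  shows "uniformly_continuous_on (ball 0 1) u"
proof (rule uniformly_continuous_on_ball_if_finite_cluster_sets[OF u])
  show "bounded (u ` ball 0 1)"
    using subordination_pairD(1)[OF uv] by (auto simp: bounded_iff intro!: exI[of _ 1] less_imp_le)
next
  fix \<zeta> :: complex assume \<zeta>: "cmod \<zeta> = 1"
  \<comment> \<open>The coefficients result from clearing denominators in the two fixed point
    equations and eliminating \<open>v z\<close>.\<close>
  define A where "A z = c * (cnj p + cnj q * d * z)" for z
  define B where "B z = 1 + (cnj q * d * p - q * cnj p * c) * z - c * d * z\<^sup>2" for z
  define C where "C z = - z * (d * p * z + q)" for z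
  have quadratic: "A z * (u z)\<^sup>2 + B z * u z + C z = 0" if z: "z \<in> ball 0 1" for z
  proof -
    have nz: "1 + cnj a * b * w \<noteq> 0" if "cmod a < 1" "cmod b = 1" "cmod w < 1" for a b w
      using one_minus_cnj_mult_nonzero[of a "- (b * w)"] that by (simp add: norm_mult mult.assoc)
    have uz: "cmod (u z) < 1" "cmod (v z) < 1" "v z = z * \<phi>1 (u z)" "u z = z * \<phi>2 (v z)"
      using subordination_pairD[OF uv, of z] z unfolding mem_ball_0 by blast+
    have "v z * (1 + cnj p * c * u z) = z * (c * u z + p)"
      using nz[OF p c uz(1)] by (subst uz(3)) (simp add: \<phi>1[OF uz(1)])
    moreover have "u z * (1 + cnj q * d * v z) = z * (d * v z + q)"
      using nz[OF q d uz(2)] by (subst uz(4)) (simp add: \<phi>2[OF uz(2)])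
    ultimately show ?thesis
      unfolding A_def B_def C_def by algebra
  qed
  show "\<exists>F. finite F \<and>
      (\<forall>\<sigma> q. (\<forall>n. \<sigma> n \<in> ball 0 1) \<longrightarrow> \<sigma> \<longlonglongrightarrow> \<zeta> \<longrightarrow> (\<lambda>n. u (\<sigma> n)) \<longlonglongrightarrow> q \<longrightarrow> q \<in> F)"
  proof (cases "A \<zeta> \<noteq> 0 \<or> B \<zeta> \<noteq> 0 \<or> C \<zeta> \<noteq> 0")
    case True
    have "continuous (at \<zeta>) A" "continuous (at \<zeta>) B" "continuous (at \<zeta>) C"
      unfolding A_def B_def C_def by (intro continuous_intros)+
    then show ?thesis
      using True quadratic by (rule finite_cluster_set_if_quadratic)
  next
    case False
    have nz: "c \<noteq> 0" "d \<noteq> 0" "\<zeta> \<noteq> 0"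
      using c d \<zeta> by auto
    have A0: "cnj p + cnj q * d * \<zeta> = 0" and B0: "B \<zeta> = 0" and C0: "q = - (d * p * \<zeta>)"
      using False nz by (auto simp: A_def C_def eq_neg_iff_add_eq_0 add.commute)
    \<comment> \<open>The quadratic equation degenerates at \<open>\<zeta>\<close>, but its coefficients share the factor \<open>z - \<zeta>\<close>,
      and it remains nontrivial at \<open>\<zeta>\<close> after division by that factor.\<close>
    define A' where "A' z = c * cnj q * d" for z :: complex
    define B' where "B' z = cnj q * d * p - q * cnj p * c - c * d * (z + \<zeta>)" for z
    define C' where "C' z = - z * (d * p)" for z
    show ?thesis
    proof (rule finite_cluster_set_if_quadratic)
      show "continuous (at \<zeta>) A'" "continuous (at \<zeta>) B'" "continuous (at \<zeta>) C'"
        unfolding A'_def B'_def C'_def by (intro continuous_intros)+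
      \<comment> \<open>If \<open>A' \<zeta>\<close> vanishes then \<open>q = 0\<close>, which
        leaves \<open>B' \<zeta> = - 2 * c * d * \<zeta>\<close>, a nonzero number.\<close>
      show "A' \<zeta> \<noteq> 0 \<or> B' \<zeta> \<noteq> 0 \<or> C' \<zeta> \<noteq> 0"
        using nz by (auto simp: A'_def B'_def C'_def)
      fix z :: complex assume z: "z \<in> ball 0 1"
      have "A z = (z - \<zeta>) * A' z"
        using A0 unfolding A_def A'_def by algebra
      moreover have "B z - B \<zeta> = (z - \<zeta>) * B' z"
        unfolding B_def B'_def by algebra
      moreover have "C z = (z - \<zeta>) * C' z"
        using C0 unfolding C_def C'_def by algebra
      ultimately have "(z - \<zeta>) * (A' z * (u z)\<^sup>2 + B' z * u z + C' z) = 0"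
        using quadratic[OF z] B0 by algebra
      then show "A' z * (u z)\<^sup>2 + B' z * u z + C' z = 0"
        using z \<zeta> by auto
    qed
  qed
qed

section \<open>Existence and uniqueness\<close>

text \<open>Each of the two stages \<open>w \<mapsto> z * \<phi> w\<close> gains a factor
  \<open>(cmod z)\<^sup>2\<close>, by the Schwarz-Pick inequality followed by
  \<open>sinh_sq_scale\<close>.\<close>

lemma fixed_point_map_contraction:
  assumes \<phi>1: "self_map_of_disc \<phi>1" and \<phi>2: "self_map_of_disc \<phi>2"
    and z: "cmod z < 1" and w: "cmod w < 1" "cmod w' < 1"
  shows "sinh_sq (z * \<phi>2 (z * \<phi>1 w)) (z * \<phi>2 (z * \<phi>1 w')) \<le> (cmod z) ^ 4 * sinh_sq w w'"
proof -
  have step: "cmod (z * \<phi> w) < 1 \<and> sinh_sq (z * \<phi> w) (z * \<phi> w') \<le> (cmod z)\<^sup>2 * sinh_sq w w'"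
    if \<phi>: "self_map_of_disc \<phi>" and w: "cmod w < 1" "cmod w' < 1" for \<phi> w w'
  proof -
    have "sinh_sq (z * \<phi> w) (z * \<phi> w') \<le> (cmod z)\<^sup>2 * sinh_sq (\<phi> w) (\<phi> w')"
      using z w self_map_of_disc_norm[OF \<phi>] by (intro sinh_sq_scale) auto
    also have "\<dots> \<le> (cmod z)\<^sup>2 * sinh_sq w w'"
      using Schwarz_Pick[OF \<phi> w] by (intro mult_left_mono) auto
    finally show ?thesis
      using norm_mult_less[OF z self_map_of_disc_norm[OF \<phi> w(1)]] by simp
  qed
  have "sinh_sq (z * \<phi>2 (z * \<phi>1 w)) (z * \<phi>2 (z * \<phi>1 w')) \<le> (cmod z)\<^sup>2 * sinh_sq (z * \<phi>1 w) (z * \<phi>1 w')"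
    using step[OF \<phi>2] step[OF \<phi>1] w by blast
  also have "\<dots> \<le> (cmod z)\<^sup>2 * ((cmod z)\<^sup>2 * sinh_sq w w')"
    using step[OF \<phi>1] w by (intro mult_left_mono) auto
  finally show ?thesis
    by (simp add: power2_eq_square power4_eq_xxxx mult_ac)
qed

section \<open>Fixed point pairs on the open disc\<close>

lemma self_map_of_disc_comp_holomorphic:
  assumes \<phi>: "self_map_of_disc \<phi>" and f: "f holomorphic_on ball 0 1" "\<And>z. cmod z < 1 \<Longrightarrow> cmod (f z) < 1"
  shows "(\<lambda>z. \<phi> (f z)) holomorphic_on ball 0 1"
proof -
  have "f ` ball 0 1 \<subseteq> ball 0 1"
    using f(2) by force
  then show ?thesis
    using holomorphic_on_compose_gen[OF f(1), of \<phi> "ball 0 1"] \<phi>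
    by (simp add: self_map_of_disc_def o_def)
qed

text \<open>Both \<open>u z\<close> and \<open>u' z\<close> are fixed points of one map that
  multiplies \<open>sinh_sq\<close> by at most \<open>(cmod z) ^ 4 < 1\<close>.\<close>

lemma subordination_pair_unique:
  assumes \<phi>1: "self_map_of_disc \<phi>1" and \<phi>2: "self_map_of_disc \<phi>2"
    and uv: "subordination_pair \<phi>1 \<phi>2 u v" and uv': "subordination_pair \<phi>1 \<phi>2 u' v'"
    and z: "cmod z < 1"
  shows "u z = u' z" and "v z = v' z"
proof -
  note * = subordination_pairD[OF uv z] and ** = subordination_pairD[OF uv' z]
  have "u z = z * \<phi>2 (z * \<phi>1 (u z))" "u' z = z * \<phi>2 (z * \<phi>1 (u' z))"
    using *(3,4) **(3,4) by metis+
  then have "sinh_sq (u z) (u' z) \<le> (cmod z) ^ 4 * sinh_sq (u z) (u' z)"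
    using fixed_point_map_contraction[OF \<phi>1 \<phi>2 z *(1) **(1)] by simp
  moreover have "(cmod z) ^ 4 < 1"
    using z by (simp add: power_less_one_iff)
  ultimately have "sinh_sq (u z) (u' z) \<le> 0"
    by - (rule ccontr, use mult_strict_right_mono[of "(cmod z) ^ 4" 1 "sinh_sq (u z) (u' z)"] in auto)
  then have "(cmod (u z - u' z))\<^sup>2 \<le> 0"
    using norm_diff_le_sinh_sq[OF *(1) **(1)] by linarith
  then show "u z = u' z"
    by simp
  then show "v z = v' z"
    using *(3) **(3) by metis
qed

text \<open>The iterates of the fixed point map started at 0 are holomorphic in the parameter
  \<open>z\<close> and converge locally uniformly, so their limit \<open>u\<close> is holomorphic as
  well.\<close>

lemma subordination_pair_exists:
  assumes \<phi>1: "self_map_of_disc \<phi>1" and \<phi>2: "self_map_of_disc \<phi>2"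
  obtains u v where "subordination_pair \<phi>1 \<phi>2 u v" "u holomorphic_on ball 0 1" "v holomorphic_on ball 0 1"
proof -
  have hol: "\<phi>1 holomorphic_on ball 0 1" "\<phi>2 holomorphic_on ball 0 1"
    using \<phi>1 \<phi>2 by (auto simp: self_map_of_disc_def)
  define f where "f z w = z * \<phi>2 (z * \<phi>1 w)" for z w
  define F where "F n z = (f z ^^ n) 0" for n z
  have F_simps: "F 0 z = 0" "F (Suc n) z = f z (F n z)" for n z
    by (simp_all add: F_def)
  have inner: "cmod (z * \<phi>1 w) < 1" if "cmod z < 1" "cmod w < 1" for z w
    using norm_mult_less[OF that(1) self_map_of_disc_norm[OF \<phi>1 that(2)]] by simp
  have f_norm: "cmod (f z w) \<le> cmod z" if "cmod z < 1" "cmod w < 1" for z w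
    using self_map_of_disc_norm[OF \<phi>2 inner[OF that]] by (simp add: f_def norm_mult mult_left_le)
  have F_norm: "cmod (F n z) \<le> cmod z" if "cmod z < 1" for n z
  proof (induction n)
    case (Suc n)
    then show ?case
      using f_norm[OF that, of "F n z"] that by (simp add: F_simps)
  qed (simp add: F_simps)
  have F_hol: "F n holomorphic_on ball 0 1" for n
  proof (induction n)
    case 0
    have "F 0 = (\<lambda>_. 0)"
      by (simp add: fun_eq_iff F_simps)
    then show ?case
      by simp
  next
    case (Suc n)
    have "cmod (F n z) < 1" if "cmod z < 1" for z
      using F_norm[OF that, of n] that by linarith
    then have "(\<lambda>z. \<phi>1 (F n z)) holomorphic_on ball 0 1"
      using Suc by (intro self_map_of_disc_comp_holomorphic[OF \<phi>1])
    then have "(\<lambda>z. z * \<phi>1 (F n z)) holomorphic_on ball 0 1"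
      by (intro holomorphic_intros)
    moreover have "cmod (z * \<phi>1 (F n z)) < 1" if "cmod z < 1" for z
      using F_norm[OF that, of n] that by (intro inner) auto
    ultimately have "(\<lambda>z. \<phi>2 (z * \<phi>1 (F n z))) holomorphic_on ball 0 1"
      by (intro self_map_of_disc_comp_holomorphic[OF \<phi>2])
    then have "(\<lambda>z. z * \<phi>2 (z * \<phi>1 (F n z))) holomorphic_on ball 0 1"
      by (intro holomorphic_intros)
    moreover have "F (Suc n) = (\<lambda>z. z * \<phi>2 (z * \<phi>1 (F n z)))"
      by (simp add: fun_eq_iff F_simps f_def)
    ultimately show ?case
      by simp
  qed
  \<comment> \<open>Since \<open>F 0 z = 0\<close> and \<open>cmod (F (Suc 0) z) \<le> r\<close>,
    the initial value of \<open>sinh_sq\<close> is at most \<open>sinh_sq (of_real r) 0\<close>.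
    Each iteration gains \<open>r ^ 4\<close>, which becomes \<open>r\<^sup>2\<close> after the
    square root.\<close>
  have F_step: "cmod (F (Suc n) z - F n z) \<le> sqrt (sinh_sq (of_real r) 0) * (r\<^sup>2) ^ n"
    if z: "cmod z \<le> r" and r: "r < 1" for n z r
  proof -
    have z1: "cmod z < 1" and r0: "0 \<le> r" and F1: "cmod (F n z) < 1" for n
      using z r F_norm[of z n] norm_ge_zero[of z] by linarith+
    have "sinh_sq (F (Suc n) z) (F n z) \<le> sinh_sq (of_real r) 0 * (r ^ 4) ^ n"
    proof (induction n)
      case 0
      have "cmod (F (Suc 0) z) \<le> cmod (of_real r :: complex)"
        using F_norm[OF z1, of "Suc 0"] z r0 by simp
      then show ?case
        using sinh_sq_zero_mono[of "F (Suc 0) z" "of_real r"] r r0 by (simp add: F_simps(1))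
    next
      case (Suc n)
      have "sinh_sq (F (Suc (Suc n)) z) (F (Suc n) z) \<le> (cmod z) ^ 4 * sinh_sq (F (Suc n) z) (F n z)"
        using fixed_point_map_contraction[OF \<phi>1 \<phi>2 z1 F1[of "Suc n"] F1[of n]]
        by (simp only: F_simps(2) f_def)
      also have "\<dots> \<le> r ^ 4 * (sinh_sq (of_real r) 0 * (r ^ 4) ^ n)"
        using Suc z sinh_sq_nonneg[OF F1 F1] by (intro mult_mono power_mono) auto
      finally show ?case
        by (simp add: mult_ac)
    qed
    then have "(cmod (F (Suc n) z - F n z))\<^sup>2 \<le> sinh_sq (of_real r) 0 * (r ^ 4) ^ n"
      using norm_diff_le_sinh_sq[OF F1[of "Suc n"] F1[of n]] by linarith
    then have "cmod (F (Suc n) z - F n z) \<le> sqrt (sinh_sq (of_real r) 0 * (r ^ 4) ^ n)"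
      by (rule real_le_rsqrt)
    also have "(r ^ 4) ^ n = ((r\<^sup>2) ^ n)\<^sup>2"
      by (simp flip: power_mult)
    finally show ?thesis
      by (simp add: real_sqrt_mult)
  qed
  \<comment> \<open>The partial sums telescope to \<open>F n z\<close> because
    \<open>F 0 z = 0\<close>, so the Weierstrass test applies to the sequence of iterates.\<close>
  define u where "u z = (\<Sum>n. F (Suc n) z - F n z)" for z
  have unif: "uniform_limit (cball 0 r) F u sequentially" if r: "r < 1" for r
  proof (cases "0 \<le> r")
    case True
    have "uniform_limit (cball 0 r) (\<lambda>n z. \<Sum>i<n. F (Suc i) z - F i z) u sequentially"
      unfolding u_def
    proof (rule Weierstrass_m_test)
      show "norm (F (Suc n) z - F n z) \<le> sqrt (sinh_sq (of_real r) 0) * (r\<^sup>2) ^ n" if "z \<in> cball 0 r" for n z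
        using F_step[OF _ r, of z n] that by simp
      have "r\<^sup>2 < 1"
        using True r by (simp add: abs_square_less_1)
      then show "summable (\<lambda>n. sqrt (sinh_sq (of_real r) 0) * (r\<^sup>2) ^ n)"
        by (intro summable_mult summable_geometric) simp
    qed
    moreover have "(\<Sum>i<n. F (Suc i) z - F i z) = F n z" for n z
      using sum_lessThan_telescope[of "\<lambda>i. F i z" n] by (simp add: F_simps(1))
    ultimately show ?thesis
      by simp
  next
    case False
    then show ?thesis
      by (simp add: uniform_limit_iff)
  qed
  have lim: "(\<lambda>n. F n z) \<longlonglongrightarrow> u z" if z: "cmod z < 1" for z
    using tendsto_uniform_limitI[OF unif[OF z]] by simp
  have u_norm: "cmod (u z) < 1" if z: "cmod z < 1" for z
  proof -
    have "cmod (u z) \<le> cmod z"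
      using F_norm[OF z] by (intro LIMSEQ_le_const2[OF tendsto_norm[OF lim[OF z]]]) auto
    then show ?thesis
      using z by simp
  qed
  have u_hol: "u holomorphic_on ball 0 1"
  proof (rule holomorphic_uniform_sequence[OF open_ball F_hol])
    fix x :: complex assume "x \<in> ball 0 1"
    then have x: "cmod x < 1" by simp
    \<comment> \<open>Uniform convergence is known on discs about 0 of radius less than 1; this
      radius keeps the disc about \<open>x\<close> inside one of them.\<close>
    let ?d = "(1 - cmod x) / 2"
    have sub: "cball x ?d \<subseteq> cball 0 ((1 + cmod x) / 2)"
    proof
      fix y assume "y \<in> cball x ?d"
      then have "cmod (y - x) \<le> ?d"
        by (simp add: dist_norm norm_minus_commute)
      then show "y \<in> cball 0 ((1 + cmod x) / 2)"
        using norm_triangle_ineq2[of y x] by (simp add: field_simps)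
    qed
    show "\<exists>d>0. cball x d \<subseteq> ball 0 1 \<and> uniform_limit (cball x d) F u sequentially"
    proof (intro exI[of _ ?d] conjI)
      show "cball x ?d \<subseteq> ball 0 1"
        using sub x by (auto simp: subset_iff)
      show "uniform_limit (cball x ?d) F u sequentially"
        using x by (intro uniform_limit_on_subset[OF unif sub]) simp
    qed (use x in simp)
  qed
  define v where "v z = z * \<phi>1 (u z)" for z
  have "(\<lambda>z. \<phi>1 (u z)) holomorphic_on ball 0 1"
    using u_hol u_norm by (rule self_map_of_disc_comp_holomorphic[OF \<phi>1])
  then have v_hol: "v holomorphic_on ball 0 1"
    unfolding v_def by (intro holomorphic_intros)
  have v_norm: "cmod (v z) < 1" if "cmod z < 1" for z
    unfolding v_def using that u_norm by (intro inner)
  have cont: "isCont \<phi>1 w" "isCont \<phi>2 w" if "cmod w < 1" for w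
    using hol[THEN holomorphic_on_imp_continuous_on] that by (auto simp: continuous_on_eq_continuous_at)
  have u_eq: "u z = z * \<phi>2 (v z)" if z: "cmod z < 1" for z
  proof (rule LIMSEQ_unique)
    show "(\<lambda>n. F (Suc n) z) \<longlonglongrightarrow> u z"
      by (rule LIMSEQ_Suc[OF lim[OF z]])
    have "(\<lambda>n. z * \<phi>1 (F n z)) \<longlonglongrightarrow> v z"
      unfolding v_def
      by (intro tendsto_mult tendsto_const isCont_tendsto_compose[OF cont(1)[OF u_norm[OF z]] lim[OF z]])
    then show "(\<lambda>n. F (Suc n) z) \<longlonglongrightarrow> z * \<phi>2 (v z)"
      unfolding F_simps f_def
      by (intro tendsto_mult tendsto_const isCont_tendsto_compose[OF cont(2)[OF v_norm[OF z]]])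
  qed
  show ?thesis
  proof (rule that[OF _ u_hol v_hol])
    show "subordination_pair \<phi>1 \<phi>2 u v"
      unfolding subordination_pair_def using u_norm v_norm u_eq v_def by blast
  qed
qed

section \<open>Passage to the closed disc\<close>

lemma closed_disc_map_extension:
  assumes u: "u holomorphic_on ball 0 1" "\<And>z. cmod z < 1 \<Longrightarrow> cmod (u z) < 1" "u 0 = 0"
    and uc: "uniformly_continuous_on (ball 0 1) u"
  obtains \<omega> where "closed_disc_map \<omega>" "\<And>z. cmod z < 1 \<Longrightarrow> \<omega> z = u z"
proof -
  obtain \<omega> where \<omega>: "uniformly_continuous_on (closure (ball 0 1)) \<omega>" "\<And>z. z \<in> ball 0 1 \<Longrightarrow> u z = \<omega> z"
    using uniformly_continuous_on_extension_on_closure[OF uc] by metis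
  have cont: "continuous_on (closure (ball 0 1)) \<omega>"
    using \<omega>(1) by (rule uniformly_continuous_imp_continuous)
  have "closed_disc_map \<omega>"
    unfolding closed_disc_map_def
  proof (intro conjI)
    show "continuous_on (cball 0 1) \<omega>"
      using cont by simp
    show "\<omega> ` cball 0 1 \<subseteq> cball 0 1"
      using image_closure_subset[OF cont, of "cball 0 1"] u(2) \<omega>(2) by (force simp: less_imp_le)
    show "\<omega> holomorphic_on ball 0 1"
      using u(1) \<omega>(2) by (rule holomorphic_transform)
    show "\<omega> 0 = 0"
      using \<omega>(2)[of 0] u(3) by simp
  qed
  then show ?thesis
    using that \<omega>(2) by simp
qed

text \<open>If modulus 1 were attained inside, the maximum principle would make
  \<open>\<omega>\<close> constant, contrary to \<open>\<omega> 0 = 0\<close>.\<close>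

lemma closed_disc_map_norm_less:
  assumes \<omega>: "closed_disc_map \<omega>" and z: "cmod z < 1"
  shows "cmod (\<omega> z) < 1"
proof (rule ccontr)
  assume "\<not> cmod (\<omega> z) < 1"
  have le: "cmod (\<omega> w) \<le> 1" if "cmod w < 1" for w
    using \<omega> that by (force simp: closed_disc_map_def)
  have hol: "\<omega> holomorphic_on ball 0 1" and \<omega>0: "\<omega> 0 = 0"
    using \<omega> by (auto simp: closed_disc_map_def)
  have "cmod (\<omega> w) \<le> cmod (\<omega> z)" if "w \<in> ball 0 1" for w
    using le[of w] that \<open>\<not> cmod (\<omega> z) < 1\<close> by simp
  then have "\<omega> constant_on ball 0 1"
    using maximum_modulus_principle[OF hol open_ball connected_ball open_ball order_refl, of z] z by simp
  then have "\<omega> z = \<omega> 0"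
    using z by (auto simp: constant_on_def)
  then show False
    using \<open>\<not> cmod (\<omega> z) < 1\<close> \<omega>0 by simp
qed

lemma closed_disc_map_eq_on_cball:
  assumes \<omega>: "closed_disc_map \<omega>" and \<nu>: "closed_disc_map \<nu>"
    and eq: "\<And>z. cmod z < 1 \<Longrightarrow> \<nu> z = \<omega> z" and z: "z \<in> cball 0 1"
  shows "\<nu> z = \<omega> z"
proof -
  have cont: "continuous_on (closure (ball 0 1)) (\<lambda>z. \<nu> z - \<omega> z)"
    using \<omega> \<nu> by (auto simp: closed_disc_map_def intro!: continuous_intros)
  have zero: "\<nu> z - \<omega> z = 0" if "z \<in> ball 0 1" for z
    using eq that by simp
  have "\<nu> z - \<omega> z = 0"
    by (rule continuous_constant_on_closure[OF cont zero]) (use z in simp_all)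
  then show ?thesis
    by simp
qed

section \<open>Cancelling common factors\<close>

lemma holomorphic_mult_eq_0_cancel:
  assumes "f holomorphic_on S" "g holomorphic_on S" "open S" "connected S"
    and "\<And>z. z \<in> S \<Longrightarrow> f z * g z = 0" and "a \<in> S" "f a \<noteq> 0" and "z \<in> S"
  shows "g z = 0"
\<comment> \<open>The factor \<open>g\<close> vanishes on the nonempty open set where
  \<open>f\<close> does not, hence on all of \<open>S\<close> by the identity theorem.\<close>
proof (rule analytic_continuation_open[of "{z \<in> S. f z \<noteq> 0}" S g "\<lambda>_. 0"])
  have "open (S \<inter> f -` (- {0}))"
    using assms(1,3) by (intro continuous_open_preimage holomorphic_on_imp_continuous_on) auto
  then show "open {z \<in> S. f z \<noteq> 0}"
    by (simp add: vimage_def Int_def)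
qed (use assms in auto)

lemma subordination_pair_if_cancelled:
  assumes \<nu>: "closed_disc_map \<nu>1" "closed_disc_map \<nu>2" and eqs: "cancelled_subordination_eqs \<phi>1 \<phi>2 \<nu>1 \<nu>2"
  shows "subordination_pair \<phi>1 \<phi>2 \<nu>1 \<nu>2"
  unfolding subordination_pair_def
proof (intro allI impI)
  fix z :: complex assume z: "cmod z < 1"
  have *: "\<nu>2 z = z * \<phi>1 (\<nu>1 z) \<and> \<nu>1 z = z * \<phi>2 (\<nu>2 z)"
  proof (cases "z = 0")
    case True
    then show ?thesis
      using \<nu> by (simp add: closed_disc_map_def)
  next
    case False
    then have "z \<in> ball 0 1 - {0}"
      using z by simp
    then have "\<phi>1 (\<nu>1 z) = \<nu>2 z / z" "\<phi>2 (\<nu>2 z) = \<nu>1 z / z"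
      using eqs unfolding cancelled_subordination_eqs_def by blast+
    then show ?thesis
      using False by simp
  qed
  show "cmod (\<nu>1 z) < 1 \<and> cmod (\<nu>2 z) < 1 \<and> \<nu>2 z = z * \<phi>1 (\<nu>1 z) \<and> \<nu>1 z = z * \<phi>2 (\<nu>2 z)"
    by (intro conjI closed_disc_map_norm_less[OF _ z] \<nu> *[THEN conjunct1] *[THEN conjunct2])
qed

text \<open>The product of \<open>\<nu> z\<close> and \<open>z * \<phi> (\<nu> z) - \<nu>' z\<close>
  vanishes throughout the disc. As \<open>\<nu>\<close> is not identically zero, the holomorphic
  second factor must vanish.\<close>

lemma subordination_eq_cancel:
  assumes \<phi>: "self_map_of_disc \<phi>" and \<nu>: "closed_disc_map \<nu>" "closed_disc_map \<nu>'"
    and eq: "\<And>z. \<lbrakk>z \<in> ball 0 1; z \<noteq> 0\<rbrakk> \<Longrightarrow> \<nu> z * \<phi> (\<nu> z) = \<nu> z * \<nu>' z / z"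
    and a: "a \<in> ball 0 1" "\<nu> a \<noteq> 0" and z: "z \<in> ball 0 1" "z \<noteq> 0"
  shows "\<phi> (\<nu> z) = \<nu>' z / z"
proof -
  have hol: "\<nu> holomorphic_on ball 0 1" "\<nu>' holomorphic_on ball 0 1"
    using \<nu> by (auto simp: closed_disc_map_def)
  have "(\<lambda>z. \<phi> (\<nu> z)) holomorphic_on ball 0 1"
    using hol(1) closed_disc_map_norm_less[OF \<nu>(1)] by (rule self_map_of_disc_comp_holomorphic[OF \<phi>])
  then have hol': "(\<lambda>z. z * \<phi> (\<nu> z) - \<nu>' z) holomorphic_on ball 0 1"
    by (intro holomorphic_on_diff holomorphic_on_mult holomorphic_on_ident hol(2))
  have zero: "\<nu> w * (w * \<phi> (\<nu> w) - \<nu>' w) = 0" if "w \<in> ball 0 1" for w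
  proof (cases "w = 0")
    case True
    then show ?thesis
      using \<nu> by (simp add: closed_disc_map_def)
  next
    case False
    have "w * (\<nu> w * \<phi> (\<nu> w)) = \<nu> w * \<nu>' w"
      by (simp only: eq[OF that False] nonzero_mult_div_cancel_left times_divide_eq_right False not_False_eq_True)
    then show ?thesis
      by (simp add: right_diff_distrib mult.left_commute)
  qed
  have "z * \<phi> (\<nu> z) - \<nu>' z = 0"
    by (rule holomorphic_mult_eq_0_cancel[OF hol(1) hol' open_ball connected_ball zero a z(1)])
  then have "\<nu>' z = z * \<phi> (\<nu> z)"
    by (rule sym[OF eq_iff_diff_eq_0[THEN iffD2]])
  then show ?thesis
    using z(2) by (simp only: nonzero_mult_div_cancel_left not_False_eq_True)
qed

text \<open>If \<open>\<phi>1\<close> is not an automorphism, strictness applies to \<open>u\<close>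
  directly. If only \<open>\<phi>2\<close> is not, it applies to \<open>v\<close>, from which
  continuity passes to \<open>u\<close>. Two automorphisms lead to the quadratic equation.\<close>

lemma subordination_pair_uniformly_continuous:
  assumes \<phi>1: "self_map_of_disc \<phi>1" and \<phi>2: "self_map_of_disc \<phi>2"
    and uv: "subordination_pair \<phi>1 \<phi>2 u v" and u: "continuous_on (ball 0 1) u"
  shows "uniformly_continuous_on (ball 0 1) u" and "uniformly_continuous_on (ball 0 1) v"
proof -
  note vu = subordination_pair_sym[OF uv]
  show uc: "uniformly_continuous_on (ball 0 1) u"
  proof (rule self_map_of_disc_cases[OF \<phi>1])
    fix \<psi> p
    assume "self_map_of_disc \<psi>" "cmod p < 1" "\<And>w. cmod w < 1 \<Longrightarrow> Moebius_function 0 p (\<phi>1 w) = w * \<psi> w"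
    then show ?thesis
      by (rule subordination_pair_uniformly_continuous_fst[OF \<phi>1 \<phi>2 uv])
  next
    fix c p
    assume c: "cmod c = 1" "cmod p < 1" "\<And>w. cmod w < 1 \<Longrightarrow> \<phi>1 w = (c * w + p) / (1 + cnj p * c * w)"
    show ?thesis
    proof (rule self_map_of_disc_cases[OF \<phi>2])
      fix \<psi> q
      assume "self_map_of_disc \<psi>" "cmod q < 1" "\<And>w. cmod w < 1 \<Longrightarrow> Moebius_function 0 q (\<phi>2 w) = w * \<psi> w"
      then have "uniformly_continuous_on (ball 0 1) v"
        by (rule subordination_pair_uniformly_continuous_fst[OF \<phi>2 \<phi>1 vu])
      then show ?thesis
        by (rule subordination_pair_uniformly_continuous_snd[OF \<phi>2 \<phi>1 vu])
    next
      fix d q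
      assume d: "cmod d = 1" "cmod q < 1" "\<And>w. cmod w < 1 \<Longrightarrow> \<phi>2 w = (d * w + q) / (1 + cnj q * d * w)"
      show ?thesis
        using c d by (rule subordination_pair_uniformly_continuous_automorphisms[OF uv u])
    qed
  qed
  show "uniformly_continuous_on (ball 0 1) v"
    by (rule subordination_pair_uniformly_continuous_snd[OF \<phi>1 \<phi>2 uv uc])
qed

theorem corollary3p3:
  fixes \<phi>1 \<phi>2 :: "complex \<Rightarrow> complex"
  assumes "self_map_of_disc \<phi>1" and "self_map_of_disc \<phi>2"
  shows "\<exists>\<omega>1 \<omega>2.
    closed_disc_map \<omega>1 \<and> closed_disc_map \<omega>2 \<and>
    subordination_eqs \<phi>1 \<phi>2 \<omega>1 \<omega>2 \<and>
    cancelled_subordination_eqs \<phi>1 \<phi>2 \<omega>1 \<omega>2 \<and>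
    (\<forall>\<nu>1 \<nu>2.
       closed_disc_map \<nu>1 \<and> closed_disc_map \<nu>2 \<and>
       subordination_eqs \<phi>1 \<phi>2 \<nu>1 \<nu>2 \<and>
       (cancelled_subordination_eqs \<phi>1 \<phi>2 \<nu>1 \<nu>2 \<or>
        (\<exists>z \<in> ball 0 1. \<nu>1 z \<noteq> 0) \<and> (\<exists>z \<in> ball 0 1. \<nu>2 z \<noteq> 0))
       \<longrightarrow> (\<forall>z \<in> cball 0 1. \<nu>1 z = \<omega>1 z \<and> \<nu>2 z = \<omega>2 z))"
proof -
  obtain u v where uv: "subordination_pair \<phi>1 \<phi>2 u v"
    and hol: "u holomorphic_on ball 0 1" "v holomorphic_on ball 0 1"
    using subordination_pair_exists[OF assms] .
  note uc = subordination_pair_uniformly_continuous[OF assms uv holomorphic_on_imp_continuous_on[OF hol(1)]]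
  have uv0: "u 0 = 0" "v 0 = 0"
    using subordination_pairD(3,4)[OF uv, of 0] by simp_all
  obtain \<omega>1 where \<omega>1: "closed_disc_map \<omega>1" "\<And>z. cmod z < 1 \<Longrightarrow> \<omega>1 z = u z"
    using closed_disc_map_extension[OF hol(1) subordination_pairD(1)[OF uv] uv0(1) uc(1)] by blast
  obtain \<omega>2 where \<omega>2: "closed_disc_map \<omega>2" "\<And>z. cmod z < 1 \<Longrightarrow> \<omega>2 z = v z"
    using closed_disc_map_extension[OF hol(2) subordination_pairD(2)[OF uv] uv0(2) uc(2)] by blast
  have eqs: "\<phi>1 (\<omega>1 z) = \<omega>2 z / z" "\<phi>2 (\<omega>2 z) = \<omega>1 z / z" if "z \<in> ball 0 1 - {0}" for z
  proof -
    have z: "cmod z < 1" "z \<noteq> 0"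
      using that by auto
    have "z * \<phi>1 (\<omega>1 z) = \<omega>2 z" "z * \<phi>2 (\<omega>2 z) = \<omega>1 z"
      unfolding \<omega>1(2)[OF z(1)] \<omega>2(2)[OF z(1)] by (rule subordination_pairD(3,4)[OF uv z(1), symmetric])+
    then show "\<phi>1 (\<omega>1 z) = \<omega>2 z / z" "\<phi>2 (\<omega>2 z) = \<omega>1 z / z"
      using nonzero_mult_div_cancel_left[OF z(2)] by metis+
  qed
  have unique: "\<nu>1 z = \<omega>1 z \<and> \<nu>2 z = \<omega>2 z"
    if \<nu>: "closed_disc_map \<nu>1" "closed_disc_map \<nu>2" and sub: "subordination_eqs \<phi>1 \<phi>2 \<nu>1 \<nu>2"
      and alt: "cancelled_subordination_eqs \<phi>1 \<phi>2 \<nu>1 \<nu>2 \<or>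
        (\<exists>z \<in> ball 0 1. \<nu>1 z \<noteq> 0) \<and> (\<exists>z \<in> ball 0 1. \<nu>2 z \<noteq> 0)"
      and z: "z \<in> cball 0 1" for \<nu>1 \<nu>2 z
  proof -
    \<comment> \<open>If neither function vanishes identically, the common factors can be cancelled,
      so both alternatives lead to a fixed point pair, which is unique on the open disc; continuity
      settles the boundary.\<close>
    have "cancelled_subordination_eqs \<phi>1 \<phi>2 \<nu>1 \<nu>2"
      using alt
    proof
      assume "(\<exists>z \<in> ball 0 1. \<nu>1 z \<noteq> 0) \<and> (\<exists>z \<in> ball 0 1. \<nu>2 z \<noteq> 0)"
      then obtain a b where ab: "a \<in> ball 0 1" "\<nu>1 a \<noteq> 0" "b \<in> ball 0 1" "\<nu>2 b \<noteq> 0"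
        by blast
      have eq: "\<nu>1 w * \<phi>1 (\<nu>1 w) = \<nu>1 w * \<nu>2 w / w" "\<nu>2 w * \<phi>2 (\<nu>2 w) = \<nu>2 w * \<nu>1 w / w"
        if "w \<in> ball 0 1" "w \<noteq> 0" for w
      proof -
        have "w \<in> ball 0 1 - {0}"
          using that by blast
        then have *: "\<nu>1 w * \<phi>1 (\<nu>1 w) = \<nu>2 w * \<phi>2 (\<nu>2 w)" "\<nu>2 w * \<phi>2 (\<nu>2 w) = \<nu>1 w * \<nu>2 w / w"
          using sub unfolding subordination_eqs_def by blast+
        show "\<nu>1 w * \<phi>1 (\<nu>1 w) = \<nu>1 w * \<nu>2 w / w"
          using * by (rule trans)
        show "\<nu>2 w * \<phi>2 (\<nu>2 w) = \<nu>2 w * \<nu>1 w / w"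
          using *(2) unfolding mult.commute[of "\<nu>1 w" "\<nu>2 w"] .
      qed
      show ?thesis
        unfolding cancelled_subordination_eqs_def
      proof (intro ballI conjI)
        fix w :: complex assume "w \<in> ball 0 1 - {0}"
        then have w: "w \<in> ball 0 1" "w \<noteq> 0"
          by auto
        show "\<phi>1 (\<nu>1 w) = \<nu>2 w / w"
          by (rule subordination_eq_cancel[OF assms(1) \<nu> eq(1) ab(1,2) w])
        show "\<phi>2 (\<nu>2 w) = \<nu>1 w / w"
          by (rule subordination_eq_cancel[OF assms(2) \<nu>(2,1) eq(2) ab(3,4) w])
      qed
    qed
    then have "subordination_pair \<phi>1 \<phi>2 \<nu>1 \<nu>2"
      by (rule subordination_pair_if_cancelled[OF \<nu>])
    note eq = subordination_pair_unique[OF assms this uv]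
    have "\<nu>1 w = \<omega>1 w" "\<nu>2 w = \<omega>2 w" if "cmod w < 1" for w
      using eq[OF that] \<omega>1(2)[OF that] \<omega>2(2)[OF that] by simp_all
    then show ?thesis
      using closed_disc_map_eq_on_cball[OF \<omega>1(1) \<nu>(1) _ z] closed_disc_map_eq_on_cball[OF \<omega>2(1) \<nu>(2) _ z]
      by blast
  qed
  have "subordination_eqs \<phi>1 \<phi>2 \<omega>1 \<omega>2"
    unfolding subordination_eqs_def by (simp add: eqs)
  moreover have "cancelled_subordination_eqs \<phi>1 \<phi>2 \<omega>1 \<omega>2"
    unfolding cancelled_subordination_eqs_def using eqs by blast
  ultimately show ?thesis
    using \<omega>1(1) \<omega>2(1) unique by (intro exI[of _ \<omega>1] exI[of _ \<omega>2]) blast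
qed

end
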